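(* Let $\mathcal{A}=(L,E,R,\partial_1,\partial_2)$ and $\mathcal{A}'=(L',E',R',\partial_1',\partial_2')$ be 2-crossed modules of commutative algebras, with $\mathcal{A}$ free up to order one with a chosen basis $B$ of $R$. Let $f,g,h\colon\mathcal{A}\to\mathcal{A}'$ be 2-crossed module maps, with homotopies $f\xrightarrow{(f,s,t)}g$, $f\xrightarrow{(f,s',t')}g$, $g\xrightarrow{(g,u,v)}h$, $g\xrightarrow{(g,u',v')}h$; let $q$ be a quadratic $(f,s,t)$-2-derivation connecting $(f,s,t)$ to $(f,s',t')$ and let $q'$ be a quadratic $(g,u,v)$-2-derivation connecting $(g,u,v)$ to $(g,u',v')$. Then the interchange law holds: $$(q\circledcirc u)\star(s'\circledcirc q')=(s\circledcirc q')\star(q\circledcirc u'),$$ and both sides are equal to $$q+q'+w^{(s,u)}-w^{(s',u')}.$$ Therefore the horizontal composition of 2-fold homotopies can be defined by $$(q\otimes q')(r)=q(r)+q'(r)+w^{(s,u)}(r)-w^{(s',u')}(r),\qquad r\in R,$$ which is a 2-fold homotopy connecting $(f,s\boxplus u,t\boxplus v)$ to $(f,s'\boxplus u',t'\boxplus v')$. Thus there is a 2-groupoid $\mathrm{HOM}(\mathcal{A},\mathcal{A}')_2$ whose objects are the 2-crossed module maps $\mathcal{A}\to\mathcal{A}'$, whose 1-morphisms are their homotopies (composed by $\boxplus$), and whose 2-morphisms are the 2-fold homotopies between homotopies (with vertical composition $\star$ and horizontal composition $\otimes$).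
   Context: Conventions. $\kappa$ is a fixed commutative ring (not necessarily with 1); all algebras are associative commutative $\kappa$-algebras, not necessarily with identity. An action of an algebra $R$ on an algebra $M$ is a $\kappa$-bilinear map $(r,m)\mapsto r\blacktriangleright m$ with $r\blacktriangleright(mm')=(r\blacktriangleright m)m'=m(r\blacktriangleright m')$ and $(rr')\blacktriangleright m=r\blacktriangleright(r'\blacktriangleright m)$. The semidirect product $R\ltimes_{\blacktriangleright}M$ is $R\times M$ with product $(r,m)(r',m')=(rr',\,r\blacktriangleright m'+r'\blacktriangleright m+mm')$. 2-crossed modules. A 2-crossed module $\mathcal{A}=(L,E,R,\partial_1,\partial_2)$ is a chain complex $L\xrightarrow{\partial_2}E\xrightarrow{\partial_1}R$ of algebras and algebra maps ($\partial_1\partial_2=0$), with actions $\blacktriangleright$ of $R$ on $E$ and $L$ such that $\partial_2(r\blacktriangleright l)=r\blacktriangleright\partial_2(l)$ and $\partial_1(r\blacktriangleright e)=r\,\partial_1(e)$ ($R$ acts on itself by multiplication), and an $R$-bilinear map (Peiffer lifting) $\{\,\otimes\,\}\colon E\otimes_R E\to L$ such that for all $l,l'\in L$, $e,e',e''\in E$, $r\in R$: (2XM1) $\partial_2\{e\otimes e'\}=ee'-\partial_1(e')\blacktriangleright e$; (2XM2) $\{\partial_2(l)\otimes\partial_2(l')\}=ll'$; (2XM3) $\{e\otimes e'e''\}=\{ee'\otimes e''\}+\partial_1(e'')\blacktriangleright\{e\otimes e'\}$; (2XM4) $\{\partial_2(l)\otimes e\}=e\blacktriangleright' l-\partial_1(e)\blacktriangleright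 l$; (2XM5) $\{e\otimes\partial_2(l)\}=e\blacktriangleright' l$; (2XM6) $r\blacktriangleright\{e\otimes e'\}=\{r\blacktriangleright e\otimes e'\}=\{e\otimes r\blacktriangleright e'\}$. Here $e\blacktriangleright' l:=\{e\otimes\partial_2(l)\}$ is an action of $E$ on $L$, for which $\partial_2\colon L\to E$ is a crossed module. Freeness. $\mathcal{A}$ is free up to order one, with chosen basis $B\subset R$, if $R$ is the free commutative $\kappa$-algebra (polynomial algebra) on the set $B$: every set map from $B$ to a commutative $\kappa$-algebra extends uniquely to an algebra map from $R$. Maps. A 2-crossed module map $f=(f_2,f_1,f_0)\colon\mathcal{A}\to\mathcal{A}'$ consists of algebra maps $f_0\colon R\to R'$, $f_1\colon E\to E'$, $f_2\colon L\to L'$ commuting with the boundary maps, with $f_1(r\blacktriangleright e)=f_0(r)\blacktriangleright f_1(e)$, $f_2(r\blacktriangleright l)=f_0(r)\blacktriangleright f_2(l)$, $f_2\{e\otimes e'\}=\{f_1(e)\otimes f_1(e')\}$. Homotopies. A quadratic $f$-derivation is a pair $(s,t)$ of $\kappa$-linear maps $s\colon R\to E'$, $t\colon E\to L'$ such that for all $r,r'\in R$, $e,e'\in E$: (D) $s(rr')=f_0(r)\blacktriangleright s(r')+f_0(r')\blacktriangleright s(r)+s(r)s(r')$; $t(ee')=\{s\partial_1(e)\otimes f_1(e')\}+\{s\partial_1(e')\otimes f_1(e)\}+f_1(e)\blacktriangleright' t(e')+f_1(e')\blacktriangleright' t(e)+s\partial_1(e)\blacktriangleright' t(e')+s\partial_1(e')\blacktriangleright'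 t(e)+t(e)t(e')$; $t(r\blacktriangleright e)=f_0(r)\blacktriangleright t(e)+\partial_1's(r)\blacktriangleright t(e)+\{s(r)\otimes f_1(e)\}-\{f_1(e)\otimes s(r)\}-\{s\partial_1(e)\otimes s(r)\}$. A linear $s\colon R\to E'$ satisfying (D) is called an $f_0$-derivation. Given a quadratic $f$-derivation $(s,t)$, the formulas $g_0=f_0+\partial_1's$, $g_1=f_1+s\partial_1+\partial_2't$, $g_2=f_2+t\partial_2$ define a 2-crossed module map $g$ (known); one says that $(f,s,t)$ is a homotopy from $f$ to $g$, written $f\xrightarrow{(f,s,t)}g$. Concatenation of homotopies ($\mathcal{A}$ free up to order one with basis $B$). Any set map $B\to E'$ extends uniquely to an $f_0$-derivation. For $f\xrightarrow{(f,s,t)}g\xrightarrow{(g,u,v)}h$, let $s\boxplus u$ be the unique $f_0$-derivation agreeing with $s+u$ on $B$. Let $\mathcal{A}_2'=(R'\ltimes_{\blacktriangleright}E')\ltimes_{\blacktriangleright_\bullet}(E'\ltimes_{\blacktriangleright'}L')$, where $(r,e)\blacktriangleright_\bullet(e',l)=(ee'+r\blacktriangleright e',\ \partial_1'(e)\blacktriangleright l+r\blacktriangleright l-\{e'\otimes e\})$. The unique algebra map $R\to\mathcal{A}_2'$ extending $b\in B\mapsto(f_0(b),s(b),u(b),0)$ has the form $r\mapsto\big(f_0(r),s(r),u(r)-\partial_2'w^{(s,u)}(r),w^{(s,u)}(r)\big)$ for a unique linear map $w^{(s,u)}\colon R\to L'$; it vanishes on $B$ and satisfies $(s\boxplus u)(r)=s(r)+u(r)-\partial_2'w^{(s,u)}(r)$.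 Put $(t\boxplus v)(e)=t(e)+v(e)+w^{(s,u)}(\partial_1(e))$. Then (known) $(s\boxplus u,t\boxplus v)$ is a quadratic $f$-derivation connecting $f$ to $h$, and with this composition $\boxplus$ the 2-crossed module maps $\mathcal{A}\to\mathcal{A}'$ (objects) and homotopies (morphisms) form a groupoid $\mathrm{HOM}(\mathcal{A},\mathcal{A}')$, with identities the pairs of zero maps. 2-fold homotopies. Given a quadratic $f$-derivation $(s,t)$, a quadratic $(f,s,t)$-2-derivation is a $\kappa$-linear map $q\colon R\to L'$ with, for all $r,r'\in R$, $q(rr')=f_0(r)\blacktriangleright q(r')+f_0(r')\blacktriangleright q(r)+s(r)\blacktriangleright' q(r')+s(r')\blacktriangleright' q(r)+q(r)q(r')$. It is a 2-fold homotopy connecting $(f,s,t)$ to $(f,s',t')$ if $s'=s+\partial_2'\circ q$ and $t'=t-q\circ\partial_1$. Vertical composition: if $q$ connects $(f,s,t)$ to $(f,s',t')$ and $p$ connects $(f,s',t')$ to $(f,s'',t'')$ then $q\star p=q+p$ connects $(f,s,t)$ to $(f,s'',t'')$; identities are the zero maps. When $\mathcal{A}$ is free up to order one with basis $B$, any set map $B\to L'$ extends uniquely to a quadratic $(f,s,t)$-2-derivation. Whiskering. Right: if $q$ connects $(f,s,t)$ to $(f,s',t')$ (both from $f$ to $g$) and $g\xrightarrow{(g,u,v)}h$, then $q\circledcirc u$ is the unique quadratic $(f,s\boxplus u,t\boxplus v)$-2-derivation agreeing with $q$ on $B$; it connects $(f,s\boxplus u,t\boxplus v)$ to $(f,s'\boxplus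 u,t'\boxplus v)$. Left: if $f\xrightarrow{(f,s,t)}g$ and $q'$ connects $(g,u,v)$ to $(g,u',v')$ (both from $g$ to $h$), then $s\circledcirc q'$ is the unique quadratic $(f,s\boxplus u,t\boxplus v)$-2-derivation agreeing with $q'$ on $B$; it connects $(f,s\boxplus u,t\boxplus v)$ to $(f,s\boxplus u',t\boxplus v')$. A 2-groupoid is a (strict) 2-category in which all 1-morphisms and all 2-morphisms are invertible. *)

theory Defs
  imports Main
begin

section \<open>Algebras over a commutative ring that need not have an identity\<close>

text \<open>
  The ground ring is a type of class \<open>comm_ring\<close>, which does not require an identity.  The six
  algebras of a pair of 2-crossed modules are types of class \<open>comm_ring\<close> with a scalar
  multiplication.  Algebras whose multiplication depends on further data (semidirect products), and
  the arbitrary algebras in the universal property of a free algebra, are records with a carrier.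
\<close>

record ('k, 'a) kalg =
  carr :: "'a set"
  add :: "'a \<Rightarrow> 'a \<Rightarrow> 'a"
  zer :: 'a
  mul :: "'a \<Rightarrow> 'a \<Rightarrow> 'a"
  scl :: "'k \<Rightarrow> 'a \<Rightarrow> 'a"

text \<open>
  The last clause is the usual convention that modules over a ring with identity are unital; it is
  void when the ground ring has no identity.
\<close>

definition kalgebra :: "('k::comm_ring, 'a) kalg \<Rightarrow> bool" where
  "kalgebra A \<longleftrightarrow>
     zer A \<in> carr A \<and>
     (\<forall>x\<in>carr A. \<forall>y\<in>carr A. add A x y \<in> carr A \<and> mul A x y \<in> carr A) \<and>
     (\<forall>c. \<forall>x\<in>carr A. scl A c x \<in> carr A) \<and>
     (\<forall>x\<in>carr A. \<forall>y\<in>carr A. \<forall>z\<in>carr A. add A (add A x y) z = add A x (add A y z)) \<and>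
     (\<forall>x\<in>carr A. \<forall>y\<in>carr A. add A x y = add A y x) \<and>
     (\<forall>x\<in>carr A. add A (zer A) x = x) \<and>
     (\<forall>x\<in>carr A. \<exists>y\<in>carr A. add A x y = zer A) \<and>
     (\<forall>x\<in>carr A. \<forall>y\<in>carr A. \<forall>z\<in>carr A. mul A (mul A x y) z = mul A x (mul A y z)) \<and>
     (\<forall>x\<in>carr A. \<forall>y\<in>carr A. mul A x y = mul A y x) \<and>
     (\<forall>x\<in>carr A. \<forall>y\<in>carr A. \<forall>z\<in>carr A. mul A (add A x y) z = add A (mul A x z) (mul A y z)) \<and>
     (\<forall>c d. \<forall>x\<in>carr A. scl A (c + d) x = add A (scl A c x) (scl A d x)) \<and>
     (\<forall>c. \<forall>x\<in>carr A. \<forall>y\<in>carr A. scl A c (add A x y) = add A (scl A c x) (scl A c y)) \<and>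
     (\<forall>c d. \<forall>x\<in>carr A. scl A (c * d) x = scl A c (scl A d x)) \<and>
     (\<forall>c. \<forall>x\<in>carr A. \<forall>y\<in>carr A. scl A c (mul A x y) = mul A (scl A c x) y) \<and>
     (\<forall>u. (\<forall>c. u * c = c) \<longrightarrow> (\<forall>x\<in>carr A. scl A u x = x))"

definition alg_hom :: "('k, 'a) kalg \<Rightarrow> ('k, 'b) kalg \<Rightarrow> ('a \<Rightarrow> 'b) \<Rightarrow> bool" where
  "alg_hom A C F \<longleftrightarrow>
     (\<forall>x\<in>carr A. F x \<in> carr C) \<and>
     (\<forall>x\<in>carr A. \<forall>y\<in>carr A. F (add A x y) = add C (F x) (F y)) \<and>
     (\<forall>x\<in>carr A. \<forall>y\<in>carr A. F (mul A x y) = mul C (F x) (F y)) \<and>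
     (\<forall>c. \<forall>x\<in>carr A. F (scl A c x) = scl C c (F x))"

definition alg_of :: "('k \<Rightarrow> 'a \<Rightarrow> 'a) \<Rightarrow> ('k, 'a::comm_ring) kalg" where
  "alg_of sm = \<lparr>carr = UNIV, add = (+), zer = 0, mul = (*), scl = sm\<rparr>"

definition klinear ::
  "('k \<Rightarrow> 'a \<Rightarrow> 'a) \<Rightarrow> ('k \<Rightarrow> 'b \<Rightarrow> 'b) \<Rightarrow> ('a::comm_ring \<Rightarrow> 'b::comm_ring) \<Rightarrow> bool" where
  "klinear sm sm' F \<longleftrightarrow> (\<forall>x y. F (x + y) = F x + F y) \<and> (\<forall>c x. F (sm c x) = sm' c (F x))"

definition kbilinear ::
  "('k \<Rightarrow> 'a \<Rightarrow> 'a) \<Rightarrow> ('k \<Rightarrow> 'b \<Rightarrow> 'b) \<Rightarrow> ('k \<Rightarrow> 'c \<Rightarrow> 'c) \<Rightarrow>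
   ('a::comm_ring \<Rightarrow> 'b::comm_ring \<Rightarrow> 'c::comm_ring) \<Rightarrow> bool" where
  "kbilinear sa sb sc F \<longleftrightarrow> (\<forall>x. klinear sb sc (F x)) \<and> (\<forall>y. klinear sa sc (\<lambda>x. F x y))"

definition is_action ::
  "('k \<Rightarrow> 'r \<Rightarrow> 'r) \<Rightarrow> ('k \<Rightarrow> 'm \<Rightarrow> 'm) \<Rightarrow> ('r::comm_ring \<Rightarrow> 'm::comm_ring \<Rightarrow> 'm) \<Rightarrow> bool" where
  "is_action sr sm act \<longleftrightarrow>
     kbilinear sr sm sm act \<and>
     (\<forall>r m m'. act r (m * m') = act r m * m' \<and> act r m * m' = m * act r m') \<and>
     (\<forall>r r' m. act (r * r') m = act r (act r' m))"

definition semidirect ::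
  "('k, 'r) kalg \<Rightarrow> ('k, 'm) kalg \<Rightarrow> ('r \<Rightarrow> 'm \<Rightarrow> 'm) \<Rightarrow> ('k, 'r \<times> 'm) kalg" where
  "semidirect R M act =
     \<lparr>carr = carr R \<times> carr M,
      add = (\<lambda>(r, m) (r', m'). (add R r r', add M m m')),
      zer = (zer R, zer M),
      mul = (\<lambda>(r, m) (r', m'). (mul R r r', add M (add M (act r m') (act r' m)) (mul M m m'))),
      scl = (\<lambda>c (r, m). (scl R c r, scl M c m))\<rparr>"

section \<open>Free algebras\<close>

definition free_wrt ::
  "'c itself \<Rightarrow> ('k::comm_ring \<Rightarrow> 'r \<Rightarrow> 'r) \<Rightarrow> 'r::comm_ring set \<Rightarrow> bool" where
  "free_wrt _ sm B \<longleftrightarrow>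
     (\<forall>(C :: ('k, 'c) kalg) \<phi>. kalgebra C \<longrightarrow> \<phi> ` B \<subseteq> carr C \<longrightarrow>
        (\<exists>!F. alg_hom (alg_of sm) C F \<and> (\<forall>b\<in>B. F b = \<phi> b)))"

text \<open>
  HOL cannot quantify over all types inside a definition.  It is enough to test the universal
  property on all algebras carried by subsets of one type that is large enough to contain a copy
  of \<open>'r\<close> and a copy of every algebra generated by \<open>B\<close>; the type of formal algebra terms is such a
  type.  The lemma \<open>free_alg_universal\<close> below shows that this yields the universal property for
  algebras on arbitrary types.
\<close>

datatype ('k, 'r) aterm =
    TGen 'r
  | TZero
  | TNeg "('k, 'r) aterm"
  | TAdd "('k, 'r) aterm" "('k, 'r) aterm"
  | TMul "('k, 'r) aterm" "('k, 'r) aterm"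
  | TScl 'k "('k, 'r) aterm"

definition free_alg :: "('k::comm_ring \<Rightarrow> 'r \<Rightarrow> 'r) \<Rightarrow> 'r::comm_ring set \<Rightarrow> bool" where
  "free_alg sm B \<longleftrightarrow> free_wrt TYPE(('k, 'r) aterm) sm B"

definition kneg :: "('k, 'c) kalg \<Rightarrow> 'c \<Rightarrow> 'c" where
  "kneg C x = (SOME y. y \<in> carr C \<and> add C x y = zer C)"

primrec teval :: "('k, 'c) kalg \<Rightarrow> ('r \<Rightarrow> 'c) \<Rightarrow> ('k, 'r) aterm \<Rightarrow> 'c" where
  "teval C \<phi> (TGen r) = \<phi> r"
| "teval C \<phi> TZero = zer C"
| "teval C \<phi> (TNeg p) = kneg C (teval C \<phi> p)"
| "teval C \<phi> (TAdd p p') = add C (teval C \<phi> p) (teval C \<phi> p')"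
| "teval C \<phi> (TMul p p') = mul C (teval C \<phi> p) (teval C \<phi> p')"
| "teval C \<phi> (TScl c p) = scl C c (teval C \<phi> p)"

definition transport :: "('k, 'c) kalg \<Rightarrow> 'c set \<Rightarrow> ('c \<Rightarrow> 'd) \<Rightarrow> ('d \<Rightarrow> 'c) \<Rightarrow> ('k, 'd) kalg" where
  "transport C S j k =
     \<lparr>carr = j ` S, add = (\<lambda>x y. j (add C (k x) (k y))), zer = j (zer C),
      mul = (\<lambda>x y. j (mul C (k x) (k y))), scl = (\<lambda>c x. j (scl C c (k x)))\<rparr>"

context
  fixes C :: "('k::comm_ring, 'c) kalg"
  assumes C: "kalgebra C"
begin

lemma kalg_zer: "zer C \<in> carr C"
  and kalg_add: "x \<in> carr C \<Longrightarrow> y \<in> carr C \<Longrightarrow> add C x y \<in> carr C"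
  and kalg_mul: "x \<in> carr C \<Longrightarrow> y \<in> carr C \<Longrightarrow> mul C x y \<in> carr C"
  and kalg_scl: "x \<in> carr C \<Longrightarrow> scl C c x \<in> carr C"
  and kalg_assoc: "x \<in> carr C \<Longrightarrow> y \<in> carr C \<Longrightarrow> z \<in> carr C \<Longrightarrow>
                     add C (add C x y) z = add C x (add C y z)"
  and kalg_comm: "x \<in> carr C \<Longrightarrow> y \<in> carr C \<Longrightarrow> add C x y = add C y x"
  and kalg_zer_add: "x \<in> carr C \<Longrightarrow> add C (zer C) x = x"
  and kalg_inv: "x \<in> carr C \<Longrightarrow> \<exists>y\<in>carr C. add C x y = zer C"
  and kalg_mul_assoc: "x \<in> carr C \<Longrightarrow> y \<in> carr C \<Longrightarrow> z \<in> carr C \<Longrightarrow>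
                         mul C (mul C x y) z = mul C x (mul C y z)"
  and kalg_mul_comm: "x \<in> carr C \<Longrightarrow> y \<in> carr C \<Longrightarrow> mul C x y = mul C y x"
  and kalg_distrib: "x \<in> carr C \<Longrightarrow> y \<in> carr C \<Longrightarrow> z \<in> carr C \<Longrightarrow>
                       mul C (add C x y) z = add C (mul C x z) (mul C y z)"
  and kalg_scl_add_left: "x \<in> carr C \<Longrightarrow> scl C (c + d) x = add C (scl C c x) (scl C d x)"
  and kalg_scl_add: "x \<in> carr C \<Longrightarrow> y \<in> carr C \<Longrightarrow>
                       scl C c (add C x y) = add C (scl C c x) (scl C c y)"
  and kalg_scl_scl: "x \<in> carr C \<Longrightarrow> scl C (c * d) x = scl C c (scl C d x)"
  and kalg_scl_mul: "x \<in> carr C \<Longrightarrow> y \<in> carr C \<Longrightarrow> scl C c (mul C x y) = mul C (scl C c x) y"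
  and kalg_scl_unit: "\<forall>c. u * c = c \<Longrightarrow> x \<in> carr C \<Longrightarrow> scl C u x = x"
  using C unfolding kalgebra_def by meson+

lemmas kalg_rules = kalg_zer kalg_add kalg_mul kalg_scl kalg_assoc kalg_comm kalg_zer_add
  kalg_mul_assoc kalg_mul_comm kalg_distrib kalg_scl_add_left kalg_scl_add kalg_scl_scl
  kalg_scl_mul kalg_scl_unit

lemma kalg_cancel:
  assumes "x \<in> carr C" "y \<in> carr C" "z \<in> carr C" "add C x y = add C x z"
  shows "y = z"
proof -
  obtain n where n: "n \<in> carr C" "add C x n = zer C" using kalg_inv assms(1) by blast
  have "y' = add C n (add C x y')" if "y' \<in> carr C" for y'
    using n assms(1) that by (metis kalg_assoc kalg_comm kalg_zer_add)
  then show ?thesis using assms by metis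
qed

lemma kneg: "x \<in> carr C \<Longrightarrow> kneg C x \<in> carr C \<and> add C x (kneg C x) = zer C"
  unfolding kneg_def by (rule someI_ex) (use kalg_inv in blast)

lemma teval_carr: "range \<phi> \<subseteq> carr C \<Longrightarrow> teval C \<phi> p \<in> carr C"
  by (induction p) (auto simp: kalg_zer kalg_add kalg_mul kalg_scl kneg)

lemma kalgebra_transport:
  assumes S: "S \<subseteq> carr C" and k: "\<And>x. x \<in> S \<Longrightarrow> k (j x) = x"
    and "zer C \<in> S"
    and cl: "\<And>x y. x \<in> S \<Longrightarrow> y \<in> S \<Longrightarrow> add C x y \<in> S" "\<And>x y. x \<in> S \<Longrightarrow> y \<in> S \<Longrightarrow> mul C x y \<in> S"
      "\<And>c x. x \<in> S \<Longrightarrow> scl C c x \<in> S" "\<And>x. x \<in> S \<Longrightarrow> kneg C x \<in> S"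
  shows "kalgebra (transport C S j k)"
proof -
  have S': "x \<in> carr C" if "x \<in> S" for x using S that by blast
  have neg: "\<exists>y\<in>S. j (add C x y) = j (zer C)" if "x \<in> S" for x
    using that kneg[OF S'[OF that]] cl(4) by metis
  show ?thesis
    unfolding kalgebra_def transport_def
    by (simp add: k assms(3) cl neg)
       (intro conjI ballI allI impI; (rule arg_cong[of _ _ j])?; (simp only: k)?;
        rule kalg_rules; (rule S')?; assumption?)
qed

end

lemma free_alg_extend:
  fixes sm :: "'k::comm_ring \<Rightarrow> 'r::comm_ring \<Rightarrow> 'r" and C :: "('k, 'c) kalg"
  assumes free: "free_alg sm B" and C: "kalgebra C" and \<phi>: "\<phi> ` B \<subseteq> carr C"
  shows "\<exists>F. alg_hom (alg_of sm) C F \<and> (\<forall>b\<in>B. F b = \<phi> b) \<and>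
             (\<forall>x. \<exists>p. F x = teval C (\<lambda>r. if r \<in> B then \<phi> r else zer C) p)"
proof -
  let ?R = "alg_of sm"
  note univ = free[unfolded free_alg_def free_wrt_def, rule_format]
  have carrR: "carr ?R = UNIV" by (simp add: alg_of_def)
  define \<psi> where "\<psi> = (\<lambda>r. if r \<in> B then \<phi> r else zer C)"
  have \<psi>: "range \<psi> \<subseteq> carr C" using \<phi> kalg_zer[OF C] by (auto simp: \<psi>_def)
  define S where "S = range (teval C \<psi> :: ('k, 'r) aterm \<Rightarrow> 'c)"
  define j where "j = (\<lambda>x. SOME p :: ('k, 'r) aterm. teval C \<psi> p = x)"
  have k: "teval C \<psi> (j x) = x" if "x \<in> S" for x
    unfolding j_def by (rule someI_ex) (use that in \<open>auto simp: S_def\<close>)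
  have S: "S \<subseteq> carr C" unfolding S_def using teval_carr[OF C \<psi>] by blast
  have cl: "zer C \<in> S" "\<And>x y. x \<in> S \<Longrightarrow> y \<in> S \<Longrightarrow> add C x y \<in> S"
    "\<And>x y. x \<in> S \<Longrightarrow> y \<in> S \<Longrightarrow> mul C x y \<in> S"
    "\<And>c x. x \<in> S \<Longrightarrow> scl C c x \<in> S" "\<And>x. x \<in> S \<Longrightarrow> kneg C x \<in> S"
    unfolding S_def using rangeI[of "teval C \<psi>" TZero]
    by (auto simp flip: teval.simps(3-6))
  define D where "D = transport C S j (teval C \<psi>)"
  have D: "kalgebra D" unfolding D_def by (rule kalgebra_transport[where j = j and k = "teval C \<psi>", OF C S k cl])
  have gen: "\<psi> b \<in> S" for b unfolding S_def by (metis rangeI teval.simps(1))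
  have carrD: "carr D = j ` S" by (simp add: D_def transport_def)
  obtain G where G: "alg_hom ?R D G" "\<forall>b\<in>B. G b = j (\<psi> b)"
    using univ[OF D, of "\<lambda>b. j (\<psi> b)"] gen unfolding carrD by blast
  have GD: "G x \<in> j ` S" for x using G(1) carrR carrD by (simp add: alg_hom_def)
  have kG: "teval C \<psi> (G x) \<in> S" for x unfolding S_def by blast
  have "alg_hom ?R C (\<lambda>x. teval C \<psi> (G x))"
    using G(1) kG S cl unfolding alg_hom_def D_def transport_def
    by (auto simp: k)
  moreover have "\<forall>b\<in>B. teval C \<psi> (G b) = \<phi> b"
  proof
    fix b assume "b \<in> B"
    then have "teval C \<psi> (G b) = \<psi> b" using G(2) k[OF gen] by simp
    then show "teval C \<psi> (G b) = \<phi> b" using \<open>b \<in> B\<close> by (simp add: \<psi>_def)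
  qed
  ultimately show ?thesis unfolding \<psi>_def by blast
qed

lemma free_alg_universal:
  fixes sm :: "'k::comm_ring \<Rightarrow> 'r::comm_ring \<Rightarrow> 'r"
  assumes R: "kalgebra (alg_of sm)" and free: "free_alg sm B"
  shows "free_wrt TYPE('c) sm B"
proof -
  let ?R = "alg_of sm"
  note univ = free[unfolded free_alg_def free_wrt_def, rule_format]
  have carrR: "carr ?R = UNIV" "zer ?R = 0" by (simp_all add: alg_of_def)
  \<comment> \<open>\<open>B\<close> generates \<open>R\<close>, because \<open>R\<close> itself is carried by a set of terms\<close>
  have gen: "\<exists>p. x = teval ?R (\<lambda>r. if r \<in> B then r else 0) p" for x
  proof -
    obtain F where F: "alg_hom ?R ?R F" "\<forall>b\<in>B. F b = b"
      "\<And>x. \<exists>p. F x = teval ?R (\<lambda>r. if r \<in> B then r else 0) p"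
      using free_alg_extend[OF free R, of "\<lambda>r. r"] unfolding carrR by blast
    define k :: "('k, 'r) aterm \<Rightarrow> 'r" where "k = (\<lambda>p. case p of TGen r \<Rightarrow> r | _ \<Rightarrow> 0)"
    define D where "D = transport ?R UNIV TGen k"
    have kT: "k (TGen r) = r" for r by (simp add: k_def)
    have D: "kalgebra D"
      unfolding D_def by (rule kalgebra_transport[OF R]) (auto simp: carrR k_def)
    have lift: "alg_hom ?R D (\<lambda>x. TGen (H x))" if "alg_hom ?R ?R H" for H
      using that unfolding alg_hom_def D_def transport_def by (auto simp: carrR kT)
    have "\<exists>!G. alg_hom ?R D G \<and> (\<forall>b\<in>B. G b = TGen b)"
      by (rule univ[OF D]) (auto simp: D_def transport_def)
    then have uniq: "G = H" if "alg_hom ?R D G \<and> (\<forall>b\<in>B. G b = TGen b)"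
      "alg_hom ?R D H \<and> (\<forall>b\<in>B. H b = TGen b)" for G H using that by blast
    have "alg_hom ?R D TGen" using lift[of "\<lambda>x. x"] by (simp add: alg_hom_def)
    then have "(\<lambda>x. TGen (F x)) = (TGen :: 'r \<Rightarrow> ('k, 'r) aterm)"
      by (intro uniq) (simp_all add: lift F(1,2))
    then have "F x = x" by (metis aterm.inject(1))
    then show ?thesis using F(3)[of x] by simp
  qed
  have uniq: "F = G"
    if C: "kalgebra C" and F: "alg_hom ?R C F" and G: "alg_hom ?R C G"
      and FG: "\<And>b. b \<in> B \<Longrightarrow> F b = G b"
    for C :: "('k, 'c) kalg" and F G
  proof -
    have mem: "F x \<in> carr C" "G x \<in> carr C" for x using F G carrR by (auto simp: alg_hom_def)
    have z: "H 0 = zer C" if H: "alg_hom ?R C H" for H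
    proof -
      have "H 0 \<in> carr C" "add C (H 0) (H 0) = H 0"
        using H unfolding alg_hom_def alg_of_def by (auto, metis add_0)
      then show ?thesis
        using kalg_cancel[OF C] kalg_zer[OF C] kalg_zer_add[OF C] kalg_comm[OF C] by metis
    qed
    have F': "F (add ?R x y) = add C (F x) (F y)" "F (mul ?R x y) = mul C (F x) (F y)"
        "F (scl ?R c x) = scl C c (F x)" for x y c
      using F carrR by (auto simp: alg_hom_def)
    have G': "G (add ?R x y) = add C (G x) (G y)" "G (mul ?R x y) = mul C (G x) (G y)"
        "G (scl ?R c x) = scl C c (G x)" for x y c
      using G carrR by (auto simp: alg_hom_def)
    have eq: "F (teval ?R (\<lambda>r. if r \<in> B then r else 0) p) =
          G (teval ?R (\<lambda>r. if r \<in> B then r else 0) p)" for p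
    proof (induction p)
      case (TGen r)
      then show ?case by (simp add: FG z[OF F] z[OF G])
    next
      case (TNeg p)
      let ?x = "teval ?R (\<lambda>r. if r \<in> B then r else 0) p"
      have "add ?R ?x (kneg ?R ?x) = 0" using kneg[OF R, of ?x] carrR by simp
      then have "add C (F ?x) (F (kneg ?R ?x)) = add C (F ?x) (G (kneg ?R ?x))"
        using F'(1) G'(1) z[OF F] z[OF G] TNeg by metis
      then have "F (kneg ?R ?x) = G (kneg ?R ?x)"
        by (rule kalg_cancel[OF C mem(1) mem(1) mem(2)])
      then show ?case by simp
    qed (simp_all add: F' G' carrR z[OF F] z[OF G])
    have "F x = G x" for x
    proof -
      obtain p where p: "x = teval ?R (\<lambda>r. if r \<in> B then r else 0) p" using gen ..
      show ?thesis unfolding p by (rule eq)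
    qed
    then show ?thesis by (rule ext)
  qed
  show ?thesis
    unfolding free_wrt_def
  proof (intro allI impI ex_ex1I)
    fix C :: "('k, 'c) kalg" and \<phi> :: "'r \<Rightarrow> 'c"
    assume "kalgebra C" "\<phi> ` B \<subseteq> carr C"
    from free_alg_extend[OF free this]
    show "\<exists>F. alg_hom ?R C F \<and> (\<forall>b\<in>B. F b = \<phi> b)" by blast
  next
    fix C :: "('k, 'c) kalg" and \<phi> :: "'r \<Rightarrow> 'c" and F G
    assume C: "kalgebra C"
      and FG: "alg_hom ?R C F \<and> (\<forall>b\<in>B. F b = \<phi> b)" "alg_hom ?R C G \<and> (\<forall>b\<in>B. G b = \<phi> b)"
    show "F = G" by (rule uniq[OF C]) (use FG in simp_all)
  qed
qed

section \<open>2-crossed modules\<close>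

record ('k, 'l, 'e, 'r) xmod2 =
  smL :: "'k \<Rightarrow> 'l \<Rightarrow> 'l"
  smE :: "'k \<Rightarrow> 'e \<Rightarrow> 'e"
  smR :: "'k \<Rightarrow> 'r \<Rightarrow> 'r"
  bd1 :: "'e \<Rightarrow> 'r"
  bd2 :: "'l \<Rightarrow> 'e"
  actE :: "'r \<Rightarrow> 'e \<Rightarrow> 'e"
  actL :: "'r \<Rightarrow> 'l \<Rightarrow> 'l"
  pf :: "'e \<Rightarrow> 'e \<Rightarrow> 'l"

text \<open>
  The action \<open>\<triangleright>'\<close> of \<open>E\<close> on \<open>L\<close> is defined by (2XM5), so (2XM5) does not reappear as an axiom below.
\<close>

definition actp :: "('k, 'l, 'e, 'r) xmod2 \<Rightarrow> 'e \<Rightarrow> 'l \<Rightarrow> 'l" where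
  "actp X e l = pf X e (bd2 X l)"

text \<open>
  A linear map on \<open>E \<otimes>\<^sub>R E\<close> is a bilinear map on \<open>E \<times> E\<close> that is balanced over \<open>R\<close>;
  \<open>R\<close>-linearity and balancedness of the Peiffer lifting together are (2XM6).
\<close>

definition is_xmod2 ::
  "('k::comm_ring, 'l::comm_ring, 'e::comm_ring, 'r::comm_ring) xmod2 \<Rightarrow> bool" where
  "is_xmod2 X \<longleftrightarrow>
     kalgebra (alg_of (smL X)) \<and> kalgebra (alg_of (smE X)) \<and> kalgebra (alg_of (smR X)) \<and>
     alg_hom (alg_of (smL X)) (alg_of (smE X)) (bd2 X) \<and>
     alg_hom (alg_of (smE X)) (alg_of (smR X)) (bd1 X) \<and>
     (\<forall>l. bd1 X (bd2 X l) = 0) \<and>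
     is_action (smR X) (smE X) (actE X) \<and>
     is_action (smR X) (smL X) (actL X) \<and>
     (\<forall>r l. bd2 X (actL X r l) = actE X r (bd2 X l)) \<and>
     (\<forall>r e. bd1 X (actE X r e) = r * bd1 X e) \<and>
     kbilinear (smE X) (smE X) (smL X) (pf X) \<and>
     \<comment> \<open>(2XM1)\<close> (\<forall>e e'. bd2 X (pf X e e') = e * e' - actE X (bd1 X e') e) \<and>
     \<comment> \<open>(2XM2)\<close> (\<forall>l l'. pf X (bd2 X l) (bd2 X l') = l * l') \<and>
     \<comment> \<open>(2XM3)\<close> (\<forall>e e' e''. pf X e (e' * e'') = pf X (e * e') e'' + actL X (bd1 X e'') (pf X e e')) \<and>
     \<comment> \<open>(2XM4)\<close> (\<forall>l e. pf X (bd2 X l) e = actp X e l - actL X (bd1 X e) l) \<and>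
     \<comment> \<open>(2XM6)\<close> (\<forall>r e e'. actL X r (pf X e e') = pf X (actE X r e) e' \<and>
                          pf X (actE X r e) e' = pf X e (actE X r e'))"

definition free_up_to_order_one ::
  "('k::comm_ring, 'l, 'e, 'r::comm_ring) xmod2 \<Rightarrow> 'r set \<Rightarrow> bool" where
  "free_up_to_order_one X B \<longleftrightarrow> free_alg (smR X) B"

record ('l, 'e, 'r, 'm, 'd, 'q) xmap =
  lvl2 :: "'l \<Rightarrow> 'm"
  lvl1 :: "'e \<Rightarrow> 'd"
  lvl0 :: "'r \<Rightarrow> 'q"

definition xmod2_map ::
  "('k, 'l::comm_ring, 'e::comm_ring, 'r::comm_ring) xmod2 \<Rightarrow>
   ('k, 'm::comm_ring, 'd::comm_ring, 'q::comm_ring) xmod2 \<Rightarrow>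
   ('l, 'e, 'r, 'm, 'd, 'q) xmap \<Rightarrow> bool" where
  "xmod2_map X Y f \<longleftrightarrow>
     alg_hom (alg_of (smL X)) (alg_of (smL Y)) (lvl2 f) \<and>
     alg_hom (alg_of (smE X)) (alg_of (smE Y)) (lvl1 f) \<and>
     alg_hom (alg_of (smR X)) (alg_of (smR Y)) (lvl0 f) \<and>
     (\<forall>l. lvl1 f (bd2 X l) = bd2 Y (lvl2 f l)) \<and>
     (\<forall>e. lvl0 f (bd1 X e) = bd1 Y (lvl1 f e)) \<and>
     (\<forall>r e. lvl1 f (actE X r e) = actE Y (lvl0 f r) (lvl1 f e)) \<and>
     (\<forall>r l. lvl2 f (actL X r l) = actL Y (lvl0 f r) (lvl2 f l)) \<and>
     (\<forall>e e'. lvl2 f (pf X e e') = pf Y (lvl1 f e) (lvl1 f e'))"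

section \<open>Homotopies and 2-fold homotopies\<close>

definition derivation ::
  "('k, 'l, 'e, 'r::comm_ring) xmod2 \<Rightarrow> ('k, 'm, 'd::comm_ring, 'q) xmod2 \<Rightarrow>
   ('r \<Rightarrow> 'q) \<Rightarrow> ('r \<Rightarrow> 'd) \<Rightarrow> bool" where
  "derivation X Y f\<^sub>0 s \<longleftrightarrow>
     klinear (smR X) (smE Y) s \<and>
     (\<forall>r r'. s (r * r') = actE Y (f\<^sub>0 r) (s r') + actE Y (f\<^sub>0 r') (s r) + s r * s r')"

definition quad_derivation ::
  "('k, 'l, 'e::comm_ring, 'r::comm_ring) xmod2 \<Rightarrow>
   ('k, 'm::comm_ring, 'd::comm_ring, 'q) xmod2 \<Rightarrow>
   ('l, 'e, 'r, 'm, 'd, 'q) xmap \<Rightarrow> ('r \<Rightarrow> 'd) \<Rightarrow> ('e \<Rightarrow> 'm) \<Rightarrow> bool" where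
  "quad_derivation X Y f s t \<longleftrightarrow>
     derivation X Y (lvl0 f) s \<and>
     klinear (smE X) (smL Y) t \<and>
     (\<forall>e e'. t (e * e') =
        pf Y (s (bd1 X e)) (lvl1 f e') + pf Y (s (bd1 X e')) (lvl1 f e)
        + actp Y (lvl1 f e) (t e') + actp Y (lvl1 f e') (t e)
        + actp Y (s (bd1 X e)) (t e') + actp Y (s (bd1 X e')) (t e) + t e * t e') \<and>
     (\<forall>r e. t (actE X r e) =
        actL Y (lvl0 f r) (t e) + actL Y (bd1 Y (s r)) (t e)
        + pf Y (s r) (lvl1 f e) - pf Y (lvl1 f e) (s r) - pf Y (s (bd1 X e)) (s r))"

definition htpy_target ::
  "('k, 'l, 'e, 'r) xmod2 \<Rightarrow> ('k, 'm::comm_ring, 'd::comm_ring, 'q::comm_ring) xmod2 \<Rightarrow>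
   ('l, 'e, 'r, 'm, 'd, 'q) xmap \<Rightarrow> ('r \<Rightarrow> 'd) \<Rightarrow> ('e \<Rightarrow> 'm) \<Rightarrow> ('l, 'e, 'r, 'm, 'd, 'q) xmap" where
  "htpy_target X Y f s t =
     \<lparr>lvl2 = (\<lambda>l. lvl2 f l + t (bd2 X l)),
      lvl1 = (\<lambda>e. lvl1 f e + s (bd1 X e) + bd2 Y (t e)),
      lvl0 = (\<lambda>r. lvl0 f r + bd1 Y (s r))\<rparr>"

definition homotopy ::
  "('k, 'l, 'e::comm_ring, 'r::comm_ring) xmod2 \<Rightarrow>
   ('k, 'm::comm_ring, 'd::comm_ring, 'q::comm_ring) xmod2 \<Rightarrow>
   ('l, 'e, 'r, 'm, 'd, 'q) xmap \<Rightarrow> ('r \<Rightarrow> 'd) \<Rightarrow> ('e \<Rightarrow> 'm) \<Rightarrow>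
   ('l, 'e, 'r, 'm, 'd, 'q) xmap \<Rightarrow> bool" where
  "homotopy X Y f s t g \<longleftrightarrow> quad_derivation X Y f s t \<and> g = htpy_target X Y f s t"

definition quad_2derivation ::
  "('k, 'l, 'e::comm_ring, 'r::comm_ring) xmod2 \<Rightarrow>
   ('k, 'm::comm_ring, 'd::comm_ring, 'q) xmod2 \<Rightarrow>
   ('l, 'e, 'r, 'm, 'd, 'q) xmap \<Rightarrow> ('r \<Rightarrow> 'd) \<Rightarrow> ('e \<Rightarrow> 'm) \<Rightarrow> ('r \<Rightarrow> 'm) \<Rightarrow> bool" where
  "quad_2derivation X Y f s t q \<longleftrightarrow>
     quad_derivation X Y f s t \<and>
     klinear (smR X) (smL Y) q \<and>
     (\<forall>r r'. q (r * r') =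
        actL Y (lvl0 f r) (q r') + actL Y (lvl0 f r') (q r)
        + actp Y (s r) (q r') + actp Y (s r') (q r) + q r * q r')"

definition cell_target_s ::
  "('k, 'm, 'd::comm_ring, 'q) xmod2 \<Rightarrow> ('r \<Rightarrow> 'd) \<Rightarrow> ('r \<Rightarrow> 'm) \<Rightarrow> 'r \<Rightarrow> 'd" where
  "cell_target_s Y s q = (\<lambda>r. s r + bd2 Y (q r))"

definition cell_target_t ::
  "('k, 'l, 'e, 'r) xmod2 \<Rightarrow> ('e \<Rightarrow> 'm::comm_ring) \<Rightarrow> ('r \<Rightarrow> 'm) \<Rightarrow> 'e \<Rightarrow> 'm" where
  "cell_target_t X t q = (\<lambda>e. t e - q (bd1 X e))"

definition connects ::
  "('k, 'l, 'e::comm_ring, 'r::comm_ring) xmod2 \<Rightarrow>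
   ('k, 'm::comm_ring, 'd::comm_ring, 'q) xmod2 \<Rightarrow>
   ('l, 'e, 'r, 'm, 'd, 'q) xmap \<Rightarrow> ('r \<Rightarrow> 'd) \<Rightarrow> ('e \<Rightarrow> 'm) \<Rightarrow> ('r \<Rightarrow> 'm) \<Rightarrow>
   ('r \<Rightarrow> 'd) \<Rightarrow> ('e \<Rightarrow> 'm) \<Rightarrow> bool" where
  "connects X Y f s t q s' t' \<longleftrightarrow>
     quad_2derivation X Y f s t q \<and> s' = cell_target_s Y s q \<and> t' = cell_target_t X t q"

section \<open>Compositions\<close>

text \<open>
  In this section \<open>B\<close> is a free basis of the algebra \<open>R\<close> of \<open>X\<close>; this is what makes the definite
  descriptions below denote.
\<close>

definition sq_alg ::
  "('k, 'm::comm_ring, 'd::comm_ring, 'q::comm_ring) xmod2 \<Rightarrow>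
   ('k, ('q \<times> 'd) \<times> ('d \<times> 'm)) kalg" where
  "sq_alg Y =
     semidirect (semidirect (alg_of (smR Y)) (alg_of (smE Y)) (actE Y))
                (semidirect (alg_of (smE Y)) (alg_of (smL Y)) (actp Y))
                (\<lambda>(r, e) (e', l). (e * e' + actE Y r e', actL Y (bd1 Y e) l + actL Y r l - pf Y e' e))"

definition sq_map ::
  "('k, 'l, 'e, 'r::comm_ring) xmod2 \<Rightarrow>
   ('k, 'm::comm_ring, 'd::comm_ring, 'q::comm_ring) xmod2 \<Rightarrow> 'r set \<Rightarrow>
   ('l, 'e, 'r, 'm, 'd, 'q) xmap \<Rightarrow> ('r \<Rightarrow> 'd) \<Rightarrow> ('r \<Rightarrow> 'd) \<Rightarrow>
   'r \<Rightarrow> ('q \<times> 'd) \<times> ('d \<times> 'm)" where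
  "sq_map X Y B f s u =
     (THE F. alg_hom (alg_of (smR X)) (sq_alg Y) F \<and>
             (\<forall>b\<in>B. F b = ((lvl0 f b, s b), (u b, 0))))"

definition wmap ::
  "('k, 'l, 'e, 'r::comm_ring) xmod2 \<Rightarrow>
   ('k, 'm::comm_ring, 'd::comm_ring, 'q::comm_ring) xmod2 \<Rightarrow> 'r set \<Rightarrow>
   ('l, 'e, 'r, 'm, 'd, 'q) xmap \<Rightarrow> ('r \<Rightarrow> 'd) \<Rightarrow> ('r \<Rightarrow> 'd) \<Rightarrow> 'r \<Rightarrow> 'm" where
  "wmap X Y B f s u =
     (THE w. klinear (smR X) (smL Y) w \<and>
             (\<forall>r. sq_map X Y B f s u r = ((lvl0 f r, s r), (u r - bd2 Y (w r), w r))))"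

definition boxplus_s ::
  "('k, 'l, 'e, 'r::comm_ring) xmod2 \<Rightarrow> ('k, 'm, 'd::comm_ring, 'q) xmod2 \<Rightarrow> 'r set \<Rightarrow>
   ('l, 'e, 'r, 'm, 'd, 'q) xmap \<Rightarrow> ('r \<Rightarrow> 'd) \<Rightarrow> ('r \<Rightarrow> 'd) \<Rightarrow> 'r \<Rightarrow> 'd" where
  "boxplus_s X Y B f s u =
     (THE d. derivation X Y (lvl0 f) d \<and> (\<forall>b\<in>B. d b = s b + u b))"

definition boxplus_t ::
  "('k, 'l, 'e, 'r::comm_ring) xmod2 \<Rightarrow>
   ('k, 'm::comm_ring, 'd::comm_ring, 'q::comm_ring) xmod2 \<Rightarrow> 'r set \<Rightarrow>
   ('l, 'e, 'r, 'm, 'd, 'q) xmap \<Rightarrow> ('r \<Rightarrow> 'd) \<Rightarrow> ('e \<Rightarrow> 'm) \<Rightarrow> ('r \<Rightarrow> 'd) \<Rightarrow> ('e \<Rightarrow> 'm) \<Rightarrow>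
   'e \<Rightarrow> 'm" where
  "boxplus_t X Y B f s t u v = (\<lambda>e. t e + v e + wmap X Y B f s u (bd1 X e))"

definition vert_comp :: "('r \<Rightarrow> 'm::comm_ring) \<Rightarrow> ('r \<Rightarrow> 'm) \<Rightarrow> 'r \<Rightarrow> 'm" where
  "vert_comp q p = (\<lambda>r. q r + p r)"

text \<open>
  For \<open>q\<close> from \<open>(f,s,t)\<close> to \<open>(f,s',t')\<close> and \<open>q'\<close> from \<open>(g,u,v)\<close> to \<open>(g,u',v')\<close>, the right whiskering of \<open>q\<close>
  by \<open>(g,u,v)\<close> and the left whiskering of \<open>q'\<close> by \<open>(f,s,t)\<close> are both 2-derivations over
  \<open>(f, s \<boxplus> u, t \<boxplus> v)\<close>.
\<close>

definition whisker_right ::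
  "('k, 'l, 'e::comm_ring, 'r::comm_ring) xmod2 \<Rightarrow>
   ('k, 'm::comm_ring, 'd::comm_ring, 'q::comm_ring) xmod2 \<Rightarrow> 'r set \<Rightarrow>
   ('l, 'e, 'r, 'm, 'd, 'q) xmap \<Rightarrow> ('r \<Rightarrow> 'd) \<Rightarrow> ('e \<Rightarrow> 'm) \<Rightarrow> ('r \<Rightarrow> 'm) \<Rightarrow>
   ('r \<Rightarrow> 'd) \<Rightarrow> ('e \<Rightarrow> 'm) \<Rightarrow> 'r \<Rightarrow> 'm" where
  "whisker_right X Y B f s t q u v =
     (THE p. quad_2derivation X Y f (boxplus_s X Y B f s u) (boxplus_t X Y B f s t u v) p \<and>
             (\<forall>b\<in>B. p b = q b))"

definition whisker_left ::
  "('k, 'l, 'e::comm_ring, 'r::comm_ring) xmod2 \<Rightarrow>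
   ('k, 'm::comm_ring, 'd::comm_ring, 'q::comm_ring) xmod2 \<Rightarrow> 'r set \<Rightarrow>
   ('l, 'e, 'r, 'm, 'd, 'q) xmap \<Rightarrow> ('r \<Rightarrow> 'd) \<Rightarrow> ('e \<Rightarrow> 'm) \<Rightarrow>
   ('r \<Rightarrow> 'd) \<Rightarrow> ('e \<Rightarrow> 'm) \<Rightarrow> ('r \<Rightarrow> 'm) \<Rightarrow> 'r \<Rightarrow> 'm" where
  "whisker_left X Y B f s t u v q' =
     (THE p. quad_2derivation X Y f (boxplus_s X Y B f s u) (boxplus_t X Y B f s t u v) p \<and>
             (\<forall>b\<in>B. p b = q' b))"

definition horiz_comp ::
  "('k, 'l, 'e, 'r::comm_ring) xmod2 \<Rightarrow>
   ('k, 'm::comm_ring, 'd::comm_ring, 'q::comm_ring) xmod2 \<Rightarrow> 'r set \<Rightarrow>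
   ('l, 'e, 'r, 'm, 'd, 'q) xmap \<Rightarrow> ('r \<Rightarrow> 'd) \<Rightarrow> ('r \<Rightarrow> 'd) \<Rightarrow> ('r \<Rightarrow> 'm) \<Rightarrow>
   ('r \<Rightarrow> 'd) \<Rightarrow> ('r \<Rightarrow> 'd) \<Rightarrow> ('r \<Rightarrow> 'm) \<Rightarrow> 'r \<Rightarrow> 'm" where
  "horiz_comp X Y B f s s' q u u' q' =
     (\<lambda>r. q r + q' r + wmap X Y B f s u r - wmap X Y B f s' u' r)"

section \<open>2-groupoids\<close>

text \<open>
  All compositions are written in diagrammatic order; outside the given sets of objects and
  morphisms, and on non-composable pairs, the operations are unconstrained.
\<close>

definition is_category ::
  "'o set \<Rightarrow> 'a set \<Rightarrow> ('a \<Rightarrow> 'o) \<Rightarrow> ('a \<Rightarrow> 'o) \<Rightarrow> ('o \<Rightarrow> 'a) \<Rightarrow> ('a \<Rightarrow> 'a \<Rightarrow> 'a) \<Rightarrow> bool" where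
  "is_category Ob Ar d c i m \<longleftrightarrow>
     (\<forall>x\<in>Ar. d x \<in> Ob \<and> c x \<in> Ob) \<and>
     (\<forall>a\<in>Ob. i a \<in> Ar \<and> d (i a) = a \<and> c (i a) = a) \<and>
     (\<forall>x\<in>Ar. \<forall>y\<in>Ar. c x = d y \<longrightarrow> m x y \<in> Ar \<and> d (m x y) = d x \<and> c (m x y) = c y) \<and>
     (\<forall>x\<in>Ar. m (i (d x)) x = x \<and> m x (i (c x)) = x) \<and>
     (\<forall>x\<in>Ar. \<forall>y\<in>Ar. \<forall>z\<in>Ar. c x = d y \<longrightarrow> c y = d z \<longrightarrow> m (m x y) z = m x (m y z))"

definition all_invertible ::
  "'a set \<Rightarrow> ('a \<Rightarrow> 'o) \<Rightarrow> ('a \<Rightarrow> 'o) \<Rightarrow> ('o \<Rightarrow> 'a) \<Rightarrow> ('a \<Rightarrow> 'a \<Rightarrow> 'a) \<Rightarrow> bool" where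
  "all_invertible Ar d c i m \<longleftrightarrow>
     (\<forall>x\<in>Ar. \<exists>y\<in>Ar. d y = c x \<and> c y = d x \<and> m x y = i (d x) \<and> m y x = i (c x))"

record ('o, 'a, 'c) two_cat =
  Obj :: "'o set"
  Arr :: "'a set"
  Cell :: "'c set"
  dom1 :: "'a \<Rightarrow> 'o"
  cod1 :: "'a \<Rightarrow> 'o"
  src2 :: "'c \<Rightarrow> 'a"
  trg2 :: "'c \<Rightarrow> 'a"
  id1 :: "'o \<Rightarrow> 'a"
  cmp1 :: "'a \<Rightarrow> 'a \<Rightarrow> 'a"
  id2 :: "'a \<Rightarrow> 'c"
  vcmp :: "'c \<Rightarrow> 'c \<Rightarrow> 'c"
  hcmp :: "'c \<Rightarrow> 'c \<Rightarrow> 'c"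

definition two_category :: "('o, 'a, 'c) two_cat \<Rightarrow> bool" where
  "two_category T \<longleftrightarrow>
     is_category (Obj T) (Arr T) (dom1 T) (cod1 T) (id1 T) (cmp1 T) \<and>
     is_category (Arr T) (Cell T) (src2 T) (trg2 T) (id2 T) (vcmp T) \<and>
     (\<forall>x\<in>Cell T. dom1 T (src2 T x) = dom1 T (trg2 T x) \<and> cod1 T (src2 T x) = cod1 T (trg2 T x)) \<and>
     is_category (Obj T) (Cell T) (\<lambda>x. dom1 T (src2 T x)) (\<lambda>x. cod1 T (src2 T x))
       (\<lambda>a. id2 T (id1 T a)) (hcmp T) \<and>
     (\<forall>x\<in>Cell T. \<forall>y\<in>Cell T. cod1 T (src2 T x) = dom1 T (src2 T y) \<longrightarrow>
        src2 T (hcmp T x y) = cmp1 T (src2 T x) (src2 T y) \<and>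
        trg2 T (hcmp T x y) = cmp1 T (trg2 T x) (trg2 T y)) \<and>
     (\<forall>a\<in>Arr T. \<forall>b\<in>Arr T. cod1 T a = dom1 T b \<longrightarrow>
        hcmp T (id2 T a) (id2 T b) = id2 T (cmp1 T a b)) \<and>
     (\<forall>x\<in>Cell T. \<forall>x'\<in>Cell T. \<forall>y\<in>Cell T. \<forall>y'\<in>Cell T.
        trg2 T x = src2 T x' \<longrightarrow> trg2 T y = src2 T y' \<longrightarrow>
        cod1 T (src2 T x) = dom1 T (src2 T y) \<longrightarrow>
        hcmp T (vcmp T x x') (vcmp T y y') = vcmp T (hcmp T x y) (hcmp T x' y'))"

definition two_groupoid :: "('o, 'a, 'c) two_cat \<Rightarrow> bool" where
  "two_groupoid T \<longleftrightarrow>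
     two_category T \<and>
     all_invertible (Arr T) (dom1 T) (cod1 T) (id1 T) (cmp1 T) \<and>
     all_invertible (Cell T) (src2 T) (trg2 T) (id2 T) (vcmp T)"

text \<open>
  A homotopy is the triple \<open>(f,s,t)\<close> and a 2-fold homotopy the quadruple \<open>(f,s,t,q)\<close>; their
  targets are determined by these data.
\<close>

definition HOM2 ::
  "('k, 'l::comm_ring, 'e::comm_ring, 'r::comm_ring) xmod2 \<Rightarrow>
   ('k, 'm::comm_ring, 'd::comm_ring, 'q::comm_ring) xmod2 \<Rightarrow> 'r set \<Rightarrow>
   (('l, 'e, 'r, 'm, 'd, 'q) xmap,
    ('l, 'e, 'r, 'm, 'd, 'q) xmap \<times> ('r \<Rightarrow> 'd) \<times> ('e \<Rightarrow> 'm),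
    ('l, 'e, 'r, 'm, 'd, 'q) xmap \<times> ('r \<Rightarrow> 'd) \<times> ('e \<Rightarrow> 'm) \<times> ('r \<Rightarrow> 'm)) two_cat" where
  "HOM2 X Y B =
     \<lparr>Obj = {f. xmod2_map X Y f},
      Arr = {(f, s, t). xmod2_map X Y f \<and> quad_derivation X Y f s t},
      Cell = {(f, s, t, q). xmod2_map X Y f \<and> quad_2derivation X Y f s t q},
      dom1 = (\<lambda>(f, s, t). f),
      cod1 = (\<lambda>(f, s, t). htpy_target X Y f s t),
      src2 = (\<lambda>(f, s, t, q). (f, s, t)),
      trg2 = (\<lambda>(f, s, t, q). (f, cell_target_s Y s q, cell_target_t X t q)),
      id1 = (\<lambda>f. (f, \<lambda>_. 0, \<lambda>_. 0)),
      cmp1 = (\<lambda>(f, s, t) (g, u, v). (f, boxplus_s X Y B f s u, boxplus_t X Y B f s t u v)),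
      id2 = (\<lambda>(f, s, t). (f, s, t, \<lambda>_. 0)),
      vcmp = (\<lambda>(f, s, t, q) (f', s', t', p). (f, s, t, vert_comp q p)),
      hcmp = (\<lambda>(f, s, t, q) (g, u, v, q').
        (f, boxplus_s X Y B f s u, boxplus_t X Y B f s t u v,
         horiz_comp X Y B f s (cell_target_s Y s q) q u (cell_target_s Y u q') q'))\<rparr>"

end

theory Submission
  imports Defs
begin

text \<open>
  Since \<open>B\<close> generates \<open>R\<close>, identities between maps on \<open>R\<close> that behave compatibly on products can be
  checked on \<open>B\<close>.  Eliminating the third component of the map to \<open>sq_alg\<close> shows that \<open>w = w(s,u)\<close> is
  the linear map vanishing on \<open>B\<close> with
  \<open>w(xy) = f\<^sub>0(x) \<triangleright> w(y) + f\<^sub>0(y) \<triangleright> w(x) + (s(x) + u(x)) \<triangleright>' w(y) + (s(y) + u(y)) \<triangleright>' w(x) - w(x)w(y)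
  - {u(x) \<otimes> s(y)} - {u(y) \<otimes> s(x)}\<close>.
  This one recursion gives everything: the cocycle identity
  \<open>w(s,u) + w(s \<boxplus> u, x) = w(u,x) + w(s, u \<boxplus> x)\<close> behind both associativity laws, and the fact that
  \<open>q + q' + w(s,u) - w(s',u')\<close> is a 2-derivation over \<open>s \<boxplus> u\<close>.  The whiskerings are the cases \<open>q' = 0\<close>
  and \<open>q = 0\<close> of the latter, so that in the interchange law the two mixed terms telescope.  Homotopies
  are inverted by extending \<open>-s\<close> from \<open>B\<close>.
\<close>

section \<open>Scalar multiplication and linear maps\<close>

lemma kalgebra_smul:
  assumes "kalgebra (alg_of sm)"
  shows "sm c (x + y) = sm c x + sm c y" "sm (c + d) x = sm c x + sm d x"
    "sm (c * d) x = sm c (sm d x)" "sm c x * y = sm c (x * y)" "x * sm c y = sm c (x * y)"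
    "\<forall>c. k * c = c \<Longrightarrow> sm k x = x"
proof -
  show *: "sm c x * y = sm c (x * y)" for c x y
    using assms unfolding kalgebra_def alg_of_def by simp
  show "x * sm c y = sm c (x * y)"
    using *[of c y x] by (simp add: mult.commute)
qed (use assms in \<open>simp_all add: kalgebra_def alg_of_def\<close>)

lemma klinearD:
  assumes "klinear sm sm' F"
  shows "F (x + y) = F x + F y" "F (sm c x) = sm' c (F x)" "F 0 = 0" "F (- x) = - F x"
    "F (x - y) = F x - F y"
proof -
  show *: "F (x + y) = F x + F y" for x y using assms by (simp add: klinear_def)
  show 0: "F 0 = 0" using *[of 0 0] by simp
  show **: "F (- x) = - F x" for x using *[of x "- x"] 0 by (simp add: eq_neg_iff_add_eq_0 add.commute)
  show "F (x - y) = F x - F y" using *[of x "- y"] ** by simp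
  show "F (sm c x) = sm' c (F x)" using assms by (simp add: klinear_def)
qed

lemma klinear_smul_diff:
  assumes "kalgebra (alg_of sm)"
  shows "sm c 0 = 0" "sm c (- x) = - sm c x" "sm c (x - y) = sm c x - sm c y"
proof -
  \<comment> \<open>Additivity of \<open>sm c\<close> is phrased as linearity over a one-point set
    of scalars acting by the identity, so that \<open>klinearD\<close> applies.\<close>
  have "klinear (\<lambda>_::unit. id) (\<lambda>_. id) (sm c)"
    by (simp add: klinear_def kalgebra_smul[OF assms])
  from klinearD(3-5)[OF this]
  show "sm c 0 = 0" "sm c (- x) = - sm c x" "sm c (x - y) = sm c x - sm c y" by auto
qed

lemma alg_hom_alg_of:
  "alg_hom (alg_of sm) (alg_of sm') F \<longleftrightarrow> klinear sm sm' F \<and> (\<forall>x y. F (x * y) = F x * F y)"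
  by (auto simp: alg_hom_def alg_of_def klinear_def)

section \<open>Induction over the generators of a free algebra\<close>

lemma kalgebra_subset:
  assumes R: "kalgebra (alg_of sm)" and "P 0" "\<And>x. P x \<Longrightarrow> P (- x)"
    "\<And>x y. P x \<Longrightarrow> P y \<Longrightarrow> P (x + y)" "\<And>x y. P x \<Longrightarrow> P y \<Longrightarrow> P (x * y)"
    "\<And>c x. P x \<Longrightarrow> P (sm c x)"
  shows "kalgebra ((alg_of sm)\<lparr>carr := {x. P x}\<rparr>)"
proof -
  have "\<exists>y. P y \<and> x + y = 0" if "P x" for x using assms(3)[OF that] by (intro exI[of _ "- x"]) simp
  with assms show ?thesis
    unfolding kalgebra_def by (simp add: alg_of_def algebra_simps)
qed

text \<open>The elements satisfying \<open>P\<close> form a subalgebra \<open>C\<close> containing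
  \<open>B\<close>. The map into \<open>C\<close> extending the inclusion of \<open>B\<close> is, as
  a map into the whole algebra, the identity by uniqueness; so every element lies in
  \<open>C\<close>. Negation has its own case because \<open>- x\<close> need not be a scalar
  multiple of \<open>x\<close> when the scalars have no identity.\<close>

lemma free_alg_induct [consumes 2, case_names gen zero neg add mul scl]:
  assumes R: "kalgebra (alg_of sm)" and free: "free_alg sm B"
    and gen: "\<And>b. b \<in> B \<Longrightarrow> P b" and "P 0" "\<And>x. P x \<Longrightarrow> P (- x)"
    "\<And>x y. P x \<Longrightarrow> P y \<Longrightarrow> P (x + y)" "\<And>x y. P x \<Longrightarrow> P y \<Longrightarrow> P (x * y)"
    "\<And>c x. P x \<Longrightarrow> P (sm c x)"
  shows "P x"
proof -
  define C where "C = (alg_of sm)\<lparr>carr := {x. P x}\<rparr>"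
  have C: "kalgebra C"
    unfolding C_def using assms(4-) by (intro kalgebra_subset[OF R]) auto
  note univ = free_alg_universal[OF R free, unfolded free_wrt_def, rule_format]
  obtain F where F: "alg_hom (alg_of sm) C F" "\<forall>b\<in>B. F b = b"
    using univ[OF C, of "\<lambda>b. b"] gen by (auto simp: C_def)
  have "\<exists>!F. alg_hom (alg_of sm) (alg_of sm) F \<and> (\<forall>b\<in>B. F b = b)"
    using univ[OF R, of "\<lambda>b. b"] by (simp add: alg_of_def)
  moreover have "alg_hom (alg_of sm) (alg_of sm) F"
    using F(1) by (auto simp: C_def alg_hom_def alg_of_def)
  moreover have "alg_hom (alg_of sm) (alg_of sm) (\<lambda>x. x)" by (simp add: alg_hom_def)
  ultimately have "F = (\<lambda>x. x)" using F(2) by blast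
  then show "P x" using F(1) by (simp add: C_def alg_hom_def alg_of_def fun_eq_iff)
qed

section \<open>Rewrite rules for derivations and maps\<close>

lemma derivation_rules:
  assumes "derivation X Y f\<^sub>0 s"
  shows "s (x + y) = s x + s y" "s (smR X c x) = smE Y c (s x)" "s 0 = 0" "s (- x) = - s x"
    "s (x - y) = s x - s y"
    "s (x * y) = actE Y (f\<^sub>0 x) (s y) + actE Y (f\<^sub>0 y) (s x) + s x * s y"
  using assms klinearD[of "smR X" "smE Y" s] by (simp_all add: derivation_def)

lemma quad_derivation_rules:
  assumes "quad_derivation X Y f s t"
  shows "derivation X Y (lvl0 f) s"
    "t (e + e') = t e + t e'" "t (smE X c e) = smL Y c (t e)" "t 0 = 0" "t (- e) = - t e"
    "t (e - e') = t e - t e'"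
    "t (e * e') =
        pf Y (s (bd1 X e)) (lvl1 f e') + pf Y (s (bd1 X e')) (lvl1 f e)
        + actp Y (lvl1 f e) (t e') + actp Y (lvl1 f e') (t e)
        + actp Y (s (bd1 X e)) (t e') + actp Y (s (bd1 X e')) (t e) + t e * t e'"
    "t (actE X r e) =
        actL Y (lvl0 f r) (t e) + actL Y (bd1 Y (s r)) (t e)
        + pf Y (s r) (lvl1 f e) - pf Y (lvl1 f e) (s r) - pf Y (s (bd1 X e)) (s r)"
  using assms klinearD[of "smE X" "smL Y" t] by (simp_all add: quad_derivation_def)

lemma quad_2derivation_rules:
  assumes "quad_2derivation X Y f s t q"
  shows "q (x + y) = q x + q y" "q (smR X c x) = smL Y c (q x)" "q 0 = 0" "q (- x) = - q x"
    "q (x - y) = q x - q y"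
    "q (x * y) = actL Y (lvl0 f x) (q y) + actL Y (lvl0 f y) (q x)
        + actp Y (s x) (q y) + actp Y (s y) (q x) + q x * q y"
  using assms klinearD[of "smR X" "smL Y" q] by (simp_all add: quad_2derivation_def)

lemma xmod2_map_rules:
  assumes "xmod2_map X Y f"
  shows "lvl0 f (x + y) = lvl0 f x + lvl0 f y" "lvl0 f (smR X c x) = smR Y c (lvl0 f x)"
    "lvl0 f 0 = 0" "lvl0 f (- x) = - lvl0 f x" "lvl0 f (x - y) = lvl0 f x - lvl0 f y"
    "lvl0 f (x * y) = lvl0 f x * lvl0 f y"
    "lvl1 f (d + e) = lvl1 f d + lvl1 f e" "lvl1 f (smE X c e) = smE Y c (lvl1 f e)"
    "lvl1 f 0 = 0" "lvl1 f (- e) = - lvl1 f e" "lvl1 f (d - e) = lvl1 f d - lvl1 f e"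
    "lvl1 f (d * e) = lvl1 f d * lvl1 f e"
    "lvl2 f (l + m) = lvl2 f l + lvl2 f m" "lvl2 f (smL X c l) = smL Y c (lvl2 f l)"
    "lvl2 f 0 = 0" "lvl2 f (- l) = - lvl2 f l" "lvl2 f (l - m) = lvl2 f l - lvl2 f m"
    "lvl2 f (l * m) = lvl2 f l * lvl2 f m"
    "lvl1 f (bd2 X l) = bd2 Y (lvl2 f l)" "lvl0 f (bd1 X e) = bd1 Y (lvl1 f e)"
    "lvl1 f (actE X x e) = actE Y (lvl0 f x) (lvl1 f e)"
    "lvl2 f (actL X x l) = actL Y (lvl0 f x) (lvl2 f l)"
    "lvl2 f (pf X d e) = pf Y (lvl1 f d) (lvl1 f e)"
  using assms klinearD[of "smR X" "smR Y" "lvl0 f"] klinearD[of "smE X" "smE Y" "lvl1 f"]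
    klinearD[of "smL X" "smL Y" "lvl2 f"] by (simp_all add: xmod2_map_def alg_hom_alg_of)

section \<open>Inverses in a category\<close>

text \<open>If \<open>y\<close> is a right inverse of \<open>x\<close> and \<open>z\<close> one of
  \<open>y\<close>, then \<open>z = (x y) z = x (y z) = x\<close>. Hence only right inverses of
  homotopies have to be constructed.\<close>

lemma all_invertible_if_right_inverse:
  assumes cat: "is_category Ob Ar d c i m"
    and right: "\<And>x. x \<in> Ar \<Longrightarrow> \<exists>y\<in>Ar. d y = c x \<and> c y = d x \<and> m x y = i (d x)"
  shows "all_invertible Ar d c i m"
  unfolding all_invertible_def
proof
  fix x assume x: "x \<in> Ar"
  have unit: "m (i (d a)) a = a" "m a (i (c a)) = a" if "a \<in> Ar" for a
    using cat that unfolding is_category_def by blast+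
  obtain y where y: "y \<in> Ar" "d y = c x" "c y = d x" "m x y = i (d x)"
    using right[OF x] by blast
  obtain z where z: "z \<in> Ar" "d z = c y" "c z = d y" "m y z = i (d y)"
    using right[OF y(1)] by blast
  have "m (m x y) z = m x (m y z)"
    using cat x y z unfolding is_category_def by metis
  moreover have "m (m x y) z = z" using unit(1)[OF z(1)] y z by simp
  moreover have "m x (m y z) = x" using unit(2)[OF x] y z by simp
  ultimately have "z = x" by simp
  then show "\<exists>y\<in>Ar. d y = c x \<and> c y = d x \<and> m x y = i (d x) \<and> m y x = i (c x)"
    using y z by auto
qed

section \<open>Actions and Peiffer liftings in one 2-crossed module\<close>

locale xmod2 =
  fixes X :: "('k::comm_ring, 'l::comm_ring, 'e::comm_ring, 'r::comm_ring) xmod2"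
  assumes is_xmod2: "is_xmod2 X"
begin

lemma kalgebras: "kalgebra (alg_of (smL X))" "kalgebra (alg_of (smE X))" "kalgebra (alg_of (smR X))"
  using is_xmod2 by (simp_all add: is_xmod2_def)

lemma linear_bd: "klinear (smL X) (smE X) (bd2 X)" "klinear (smE X) (smR X) (bd1 X)"
  using is_xmod2 by (simp_all add: is_xmod2_def alg_hom_alg_of)

lemma linear_act:
  "klinear (smE X) (smE X) (actE X r)" "klinear (smR X) (smE X) (\<lambda>r. actE X r e)"
  "klinear (smL X) (smL X) (actL X r)" "klinear (smR X) (smL X) (\<lambda>r. actL X r l)"
  "klinear (smE X) (smL X) (pf X e)" "klinear (smE X) (smL X) (\<lambda>e'. pf X e' e)"
  using is_xmod2 by (simp_all add: is_xmod2_def is_action_def kbilinear_def)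

lemmas additive [simp] =
  kalgebra_smul(1-5)[OF kalgebras(1)] kalgebra_smul(1-5)[OF kalgebras(2)]
  kalgebra_smul(1-5)[OF kalgebras(3)]
  klinear_smul_diff[OF kalgebras(1)] klinear_smul_diff[OF kalgebras(2)]
  klinear_smul_diff[OF kalgebras(3)]
  linear_bd[THEN klinearD(1)] linear_bd[THEN klinearD(2)] linear_bd[THEN klinearD(3)]
  linear_bd[THEN klinearD(4)] linear_bd[THEN klinearD(5)]
  linear_act[THEN klinearD(1)] linear_act[THEN klinearD(2)] linear_act[THEN klinearD(3)]
  linear_act[THEN klinearD(4)] linear_act[THEN klinearD(5)]

lemma bd_rules [simp]:
  "bd2 X (l * m) = bd2 X l * bd2 X m" "bd1 X (e * e') = bd1 X e * bd1 X e'"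
  "bd1 X (bd2 X l) = 0"
  "bd2 X (actL X r l) = actE X r (bd2 X l)" "bd1 X (actE X r e) = r * bd1 X e"
  "bd2 X (pf X e e') = e * e' - actE X (bd1 X e') e"
  using is_xmod2 by (simp_all add: is_xmod2_def alg_hom_alg_of)

lemma linear_actp: "klinear (smL X) (smL X) (actp X e)" "klinear (smE X) (smL X) (\<lambda>e. actp X e l)"
  by (simp_all add: klinear_def actp_def)

lemmas additive_actp [simp] =
  linear_actp[THEN klinearD(1)] linear_actp[THEN klinearD(2)] linear_actp[THEN klinearD(3)]
  linear_actp[THEN klinearD(4)] linear_actp[THEN klinearD(5)]

lemma act_rules [simp]:
  "actE X r e * e' = actE X r (e * e')" "e * actE X r e' = actE X r (e * e')"
  "actL X r l * m = actL X r (l * m)" "l * actL X r m = actL X r (l * m)"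
  "actE X (r * r') e = actE X r (actE X r' e)" "actL X (r * r') l = actL X r (actL X r' l)"
proof -
  have E: "is_action (smR X) (smE X) (actE X)" and L: "is_action (smR X) (smL X) (actL X)"
    using is_xmod2 by (simp_all add: is_xmod2_def)
  show "actE X r e * e' = actE X r (e * e')" "e * actE X r e' = actE X r (e * e')"
    "actE X (r * r') e = actE X r (actE X r' e)"
    using E unfolding is_action_def by metis+
  show "actL X r l * m = actL X r (l * m)" "l * actL X r m = actL X r (l * m)"
    "actL X (r * r') l = actL X r (actL X r' l)"
    using L unfolding is_action_def by metis+
qed

text \<open>With \<open>act_rules\<close> this yields a normal form: actions are moved out of
  products, and ordered rewriting sorts the nested ones.\<close>

lemma act_commute:
  "actE X r (actE X r' e) = actE X r' (actE X r e)" "actL X r (actL X r' l) = actL X r' (actL X r l)"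
  by (metis act_rules(5) mult.commute, metis act_rules(6) mult.commute)

lemma
  pf_mult_right: "pf X e (e' * e'') = pf X (e * e') e'' + actL X (bd1 X e'') (pf X e e')" and
  pf_bd2_bd2: "pf X (bd2 X l) (bd2 X l') = l * l'" and
  pf_bd2_left: "pf X (bd2 X l) e = actp X e l - actL X (bd1 X e) l" and
  pf_act: "pf X (actE X r e) e' = actL X r (pf X e e')" "pf X e (actE X r e') = actL X r (pf X e e')"
  using is_xmod2 unfolding is_xmod2_def by metis+

lemmas pf_rules [simp] = actp_def[symmetric] pf_bd2_left pf_act

text \<open>From (2XM2); this is the Peiffer identity of the crossed module
  \<open>bd2 X\<close>.\<close>

lemma actp_bd2 [simp]: "actp X (bd2 X l) m = l * m"
  by (simp add: actp_def pf_bd2_bd2 del: pf_rules)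

lemma actp_act [simp]:
  "actp X (actE X r e) l = actL X r (actp X e l)" "actp X e (actL X r l) = actL X r (actp X e l)"
  by (simp_all add: actp_def del: pf_rules(1))

lemma bd2_actp [simp]: "bd2 X (actp X e l) = e * bd2 X l"
  by (simp add: actp_def del: pf_rules(1))

text \<open>The left side is the lifting of \<open>e\<close> with the boundary of
  \<open>pf X e' e''\<close>, which (2XM1) computes; the term subtracted there cancels the
  correction term of (2XM3).\<close>

lemma actp_pf: "actp X e (pf X e' e'') = pf X (e * e') e''"
  unfolding actp_def by (simp add: pf_mult_right del: pf_rules(1,2))

text \<open>The case \<open>e'' = bd2 X l\<close> of \<open>actp_pf\<close>. With
  \<open>mult_actp\<close> it shows that \<open>actp X\<close> is an action, a consequence of the
  axioms rather than one of them.\<close>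

lemma actp_mult [simp]: "actp X (e * e') l = actp X e (actp X e' l)"
  using actp_pf[of e e' "bd2 X l"] by simp

lemma actp_commute: "actp X e (actp X e' l) = actp X e' (actp X e l)"
  by (metis actp_mult mult.commute)

lemma mult_actp [simp]: "actp X e l * m = actp X e (l * m)" "l * actp X e m = actp X e (l * m)"
proof -
  show *: "actp X e l * m = actp X e (l * m)" for l m
    using actp_bd2[of "actp X e l" m] by simp
  show "l * actp X e m = actp X e (l * m)"
    using *[of m l] by (simp add: mult.commute)
qed

lemma pf_mult [simp]:
  "pf X (e * e') e'' = actp X e (pf X e' e'')"
  "pf X e (e' * e'') = actp X e (pf X e' e'') + actL X (bd1 X e'') (pf X e e')"
  by (simp_all add: actp_pf pf_mult_right)

lemma actp_pf_commute: "actp X e (pf X e' e'') = actp X e' (pf X e e'')"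
  by (metis actp_pf mult.commute)

text \<open>
  Commutativity of \<open>E\<close> applied to (2XM3) gives a relation that is not oriented as a rewrite rule
  below; it is needed only for the associativity of \<open>sq_alg X\<close>.
\<close>

lemma actp_pf_swap:
  "actp X e (pf X e' e'') = actp X e (pf X e'' e') + actL X (bd1 X e') (pf X e e'') - actL X (bd1 X e'') (pf X e e')"
  using pf_mult(2)[of e e' e''] pf_mult(2)[of e e'' e']
  by (simp add: mult.commute[of e' e''] eq_diff_eq del: pf_mult)

text \<open>By \<open>actp_bd2\<close>, multiplying by an element of \<open>L\<close> is acting by
  its boundary, and (2XM1) gives the boundary of a Peiffer lifting.\<close>

lemma pf_times [simp]:
  "pf X e e' * l = actp X e (actp X e' l) - actL X (bd1 X e') (actp X e l)"
  "l * pf X e e' = actp X e (actp X e' l) - actL X (bd1 X e') (actp X e l)"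
  using actp_bd2[of "pf X e e'" l] by (simp_all add: mult.commute)

lemmas xmod2_simps = algebra_simps act_commute actp_commute actp_pf_commute

section \<open>The iterated semidirect product\<close>

lemma sq_alg_simps:
  "carr (sq_alg X) = UNIV" "zer (sq_alg X) = ((0, 0), (0, 0))"
  "add (sq_alg X) ((r, e), (e', l)) ((r', d), (d', m)) = ((r + r', e + d), (e' + d', l + m))"
  "mul (sq_alg X) ((r, e), (e', l)) ((r', d), (d', m)) =
     ((r * r', actE X r d + actE X r' e + e * d),
      (e * d' + actE X r d' + (d * e' + actE X r' e') + e' * d',
       actL X (bd1 X e) m + actL X r m - pf X d' e + (actL X (bd1 X d) l + actL X r' l - pf X e' d)
       + (actp X e' m + actp X d' l + l * m)))"
  "scl (sq_alg X) c ((r, e), (e', l)) = ((smR X c r, smE X c e), (smE X c e', smL X c l))"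
  by (simp_all add: sq_alg_def semidirect_def alg_of_def)

lemma kalgebra_sq_alg: "kalgebra (sq_alg X)"
proof -
  have inv: "\<exists>y. x + y = 0" for x :: "'z::ab_group_add"
    by (intro exI[of _ "- x"]) simp
  have u: "smL X c x = x" "smE X c y = y" "smR X c z = z" if "\<forall>d. c * d = d" for c x y z
    using that kalgebra_smul(6) kalgebras by blast+
  \<comment> \<open>Associativity in the last component comes down to this identity, the sum of two
    instances of \<open>actp_pf_swap\<close>.\<close>
  have swap: "actp X b (pf X a d) + (actp X c (pf X e d) + (actL X (bd1 X d) (pf X c e) + actL X (bd1 X d) (pf X a b)))
    = actp X d (pf X c e) + (actp X d (pf X a b) + (actL X (bd1 X b) (pf X a d) + actL X (bd1 X e) (pf X c d)))"
    for a b c d e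
    using actp_pf_swap[of a b d] actp_pf_swap[of c e d]
    by (simp add: actp_pf_commute[of b a] actp_pf_commute[of d])
  show ?thesis
    unfolding kalgebra_def
    by (simp add: sq_alg_simps inv u split_paired_all) (auto simp: sq_alg_simps xmod2_simps swap)
qed
end

section \<open>The map \<open>w(s,u)\<close> and its recursion\<close>

locale xmod2_pair = A: xmod2 A + A': xmod2 A'
  for A :: "('k::comm_ring, 'l::comm_ring, 'e::comm_ring, 'r::comm_ring) xmod2"
    and A' :: "('k, 'm::comm_ring, 'd::comm_ring, 'q::comm_ring) xmod2" +
  fixes B :: "'r set"
  assumes free: "free_alg (smR A) B"
begin

lemmas gen_induct [case_names gen zero neg add mul scl] = free_alg_induct[OF A.kalgebras(3) free]

text \<open>The algebra map into \<open>sq_alg A'\<close> is split into four linear components. Once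
  the first three are known, the multiplication law of the fourth becomes the recursion for
  \<open>w\<close>.\<close>

lemma wmap:
  assumes f: "xmod2_map A A' f" and s: "derivation A A' (lvl0 f) s"
    and u: "derivation A A' (\<lambda>r. lvl0 f r + bd1 A' (s r)) u"
  defines "w \<equiv> wmap A A' B f s u"
  shows "klinear (smR A) (smL A') w" and "\<And>b. b \<in> B \<Longrightarrow> w b = 0"
    and "w (x * y) = actL A' (lvl0 f x) (w y) + actL A' (lvl0 f y) (w x)
       + actp A' (s x + u x) (w y) + actp A' (s y + u y) (w x) - w x * w y
       - pf A' (u x) (s y) - pf A' (u y) (s x)"
proof -
  define F where "F = sq_map A A' B f s u"
  note univ = free_alg_universal[OF A.kalgebras(3) free, unfolded free_wrt_def, rule_format]
  have "\<exists>!F. alg_hom (alg_of (smR A)) (sq_alg A') F \<and> (\<forall>b\<in>B. F b = ((lvl0 f b, s b), (u b, 0)))"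
    using univ[OF A'.kalgebra_sq_alg, of "\<lambda>b. ((lvl0 f b, s b), (u b, 0))"]
    by (simp add: A'.sq_alg_simps)
  from theI'[OF this] have hom: "alg_hom (alg_of (smR A)) (sq_alg A') F"
    and onB: "b \<in> B \<Longrightarrow> F b = ((lvl0 f b, s b), (u b, 0))" for b
    by (auto simp: F_def sq_map_def)
  define p \<sigma> z v where comp: "p = (\<lambda>r. fst (fst (F r)))" "\<sigma> = (\<lambda>r. snd (fst (F r)))"
    "z = (\<lambda>r. fst (snd (F r)))" "v = (\<lambda>r. snd (snd (F r)))"
  have F: "F r = ((p r, \<sigma> r), (z r, v r))" for r by (simp add: comp)
  have lin: "klinear (smR A) (smR A') p" "klinear (smR A) (smE A') \<sigma>"
    "klinear (smR A) (smE A') z" "klinear (smR A) (smL A') v"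
    using hom by (simp_all add: alg_hom_def alg_of_def klinear_def F A'.sq_alg_simps)
  note lin' = lin[THEN klinearD(1)] lin[THEN klinearD(2)] lin[THEN klinearD(3)] lin[THEN klinearD(4)]
  have hom_mul: "p (x * y) = p x * p y"
    "\<sigma> (x * y) = actE A' (p x) (\<sigma> y) + actE A' (p y) (\<sigma> x) + \<sigma> x * \<sigma> y"
    "z (x * y) = \<sigma> x * z y + actE A' (p x) (z y) + (\<sigma> y * z x + actE A' (p y) (z x)) + z x * z y"
    "v (x * y) = actL A' (bd1 A' (\<sigma> x)) (v y) + actL A' (p x) (v y) - pf A' (z y) (\<sigma> x)
       + (actL A' (bd1 A' (\<sigma> y)) (v x) + actL A' (p y) (v x) - pf A' (z x) (\<sigma> y))
       + (actp A' (z x) (v y) + actp A' (z y) (v x) + v x * v y)" for x y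
    using hom by (simp_all add: alg_hom_def alg_of_def F A'.sq_alg_simps)
  note rules = xmod2_map_rules[OF f] derivation_rules[OF s] derivation_rules[OF u]
  \<comment> \<open>The three identities are proved together, since the product law of
    \<open>z\<close> involves \<open>p\<close> and \<open>\<sigma>\<close>.\<close>
  have eq: "p r = lvl0 f r \<and> \<sigma> r = s r \<and> z r = u r - bd2 A' (v r)" for r
  proof (induction r rule: gen_induct)
    case (gen b)
    with F[of b] show ?case using \<open>b \<in> B\<close> by (simp add: onB)
  next
    case (mul x y)
    then show ?case by (simp add: hom_mul rules) (simp add: A'.xmod2_simps)
  qed (simp_all add: lin' rules)
  have "w = v"
    unfolding w_def wmap_def
  proof (rule the_equality)
    show "klinear (smR A) (smL A') v \<and>
      (\<forall>r. sq_map A A' B f s u r = ((lvl0 f r, s r), u r - bd2 A' (v r), v r))"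
      using lin(4) F eq by (simp add: F_def)
  next
    fix w' assume "klinear (smR A) (smL A') w' \<and>
      (\<forall>r. sq_map A A' B f s u r = ((lvl0 f r, s r), u r - bd2 A' (w' r), w' r))"
    then show "w' = v" using F by (auto simp: F_def fun_eq_iff)
  qed
  then show "klinear (smR A) (smL A') w" "\<And>b. b \<in> B \<Longrightarrow> w b = 0"
    using lin(4) onB F by auto
  show "w (x * y) = actL A' (lvl0 f x) (w y) + actL A' (lvl0 f y) (w x)
       + actp A' (s x + u x) (w y) + actp A' (s y + u y) (w x) - w x * w y
       - pf A' (u x) (s y) - pf A' (u y) (s x)"
    unfolding \<open>w = v\<close> hom_mul(4) by (simp add: eq) (simp add: A'.xmod2_simps)
qed

section \<open>Targets of homotopies and of 2-fold homotopies\<close>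

lemma htpy_target_simps [simp]:
  "lvl0 (htpy_target A A' f s t) = (\<lambda>r. lvl0 f r + bd1 A' (s r))"
  "lvl1 (htpy_target A A' f s t) = (\<lambda>e. lvl1 f e + s (bd1 A e) + bd2 A' (t e))"
  "lvl2 (htpy_target A A' f s t) = (\<lambda>l. lvl2 f l + t (bd2 A l))"
  by (simp_all add: htpy_target_def)

lemma xmod2_map_htpy_target:
  assumes f: "xmod2_map A A' f" and st: "quad_derivation A A' f s t"
  shows "xmod2_map A A' (htpy_target A A' f s t)"
proof -
  note rules = xmod2_map_rules[OF f] quad_derivation_rules[OF st]
    derivation_rules[OF quad_derivation_rules(1)[OF st]]
  show ?thesis
    unfolding xmod2_map_def alg_hom_alg_of klinear_def
    \<comment> \<open>The first pass expands by the defining laws; the second sorts actions and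
      liftings by the commutation rules. Later verifications follow the same pattern.\<close>
    by (intro conjI allI) (simp_all add: rules, simp_all add: A'.xmod2_simps)
qed

text \<open>The target map is unchanged because the contributions of \<open>q\<close> cancel at
  level 1 and vanish at levels 0 and 2 by \<open>bd1 (bd2 l) = 0\<close>.\<close>

lemma cell_target:
  assumes f: "xmod2_map A A' f" and q: "quad_2derivation A A' f s t q"
  shows "quad_derivation A A' f (cell_target_s A' s q) (cell_target_t A t q)"
    and "htpy_target A A' f (cell_target_s A' s q) (cell_target_t A t q) = htpy_target A A' f s t"
proof -
  have st: "quad_derivation A A' f s t" using q by (simp add: quad_2derivation_def)
  note rules = xmod2_map_rules[OF f] quad_derivation_rules[OF st] quad_2derivation_rules[OF q]
    derivation_rules[OF quad_derivation_rules(1)[OF st]]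
  show "quad_derivation A A' f (cell_target_s A' s q) (cell_target_t A t q)"
    unfolding quad_derivation_def derivation_def klinear_def cell_target_s_def cell_target_t_def
    by (intro conjI allI) (simp_all add: rules, simp_all add: A'.xmod2_simps)
  show "htpy_target A A' f (cell_target_s A' s q) (cell_target_t A t q) = htpy_target A A' f s t"
    by (simp add: htpy_target_def cell_target_s_def cell_target_t_def rules)
qed

section \<open>Concatenation of homotopies\<close>

text \<open>\<open>u\<close> is a derivation over the target of \<open>s\<close>, not over
  \<open>f\<close>. By (2XM1) the lifting terms in the recursion for \<open>w\<close> cancel the
  surplus \<open>bd1 (s y) \<triangleright> u x\<close> and supply the mixed product
  \<open>u x * s y\<close>.\<close>

lemma derivation_boxplus:
  assumes f: "xmod2_map A A' f" and s: "derivation A A' (lvl0 f) s"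
    and u: "derivation A A' (\<lambda>r. lvl0 f r + bd1 A' (s r)) u"
  shows "derivation A A' (lvl0 f) (\<lambda>r. s r + u r - bd2 A' (wmap A A' B f s u r))"
proof -
  note rules = xmod2_map_rules[OF f] derivation_rules[OF s] derivation_rules[OF u] wmap[OF f s u]
    klinearD[OF wmap(1)[OF f s u]]
  show ?thesis
    unfolding derivation_def klinear_def
    by (intro conjI allI) (simp_all add: rules, simp_all add: A'.xmod2_simps)
qed

lemma derivation_extend:
  assumes f: "xmod2_map A A' f"
  obtains s where "derivation A A' (lvl0 f) s" "\<And>b. b \<in> B \<Longrightarrow> s b = d b"
proof -
  note univ = free_alg_universal[OF A.kalgebras(3) free, unfolded free_wrt_def, rule_format]
  \<comment> \<open>the subalgebra \<open>R' \<ltimes> E'\<close> of \<open>sq_alg A'\<close> classifies derivations\<close>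
  obtain F where hom: "alg_hom (alg_of (smR A)) (sq_alg A') F"
    and onB: "\<And>b. b \<in> B \<Longrightarrow> F b = ((lvl0 f b, d b), (0, 0))"
    using univ[OF A'.kalgebra_sq_alg, of "\<lambda>b. ((lvl0 f b, d b), (0, 0))"]
    by (auto simp: A'.sq_alg_simps)
  define p s z v where comp: "p = (\<lambda>r. fst (fst (F r)))" "s = (\<lambda>r. snd (fst (F r)))"
    "z = (\<lambda>r. fst (snd (F r)))" "v = (\<lambda>r. snd (snd (F r)))"
  have F: "F r = ((p r, s r), (z r, v r))" for r by (simp add: comp)
  have lin: "klinear (smR A) (smR A') p" "klinear (smR A) (smE A') s"
    and mul: "p (x * y) = p x * p y"
    "s (x * y) = actE A' (p x) (s y) + actE A' (p y) (s x) + s x * s y" for x y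
    using hom by (simp_all add: alg_hom_def alg_of_def klinear_def F A'.sq_alg_simps)
  have "p r = lvl0 f r" for r
  proof (induction r rule: gen_induct)
    case (gen b)
    then show ?case using F[of b] by (simp add: onB)
  qed (simp_all add: mul xmod2_map_rules[OF f] klinearD[OF lin(1)])
  then have "derivation A A' (lvl0 f) s"
    by (simp add: derivation_def lin mul)
  moreover have "s b = d b" if "b \<in> B" for b using F[of b] onB[OF that] by simp
  ultimately show ?thesis using that by blast
qed

lemma derivation_unique:
  assumes s: "derivation A A' f\<^sub>0 s" and s': "derivation A A' f\<^sub>0 s'"
    and "\<And>b. b \<in> B \<Longrightarrow> s b = s' b"
  shows "s = s'"
proof
  fix r
  show "s r = s' r"
    by (induction r rule: gen_induct)
      (simp_all add: assms(3) derivation_rules[OF s] derivation_rules[OF s'])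
qed

lemma quad_2derivation_unique:
  assumes p: "quad_2derivation A A' f s t p" and q: "quad_2derivation A A' f s t q"
    and "\<And>b. b \<in> B \<Longrightarrow> p b = q b"
  shows "p = q"
proof
  fix r
  show "p r = q r"
    by (induction r rule: gen_induct)
      (simp_all add: assms(3) quad_2derivation_rules[OF p] quad_2derivation_rules[OF q])
qed

lemma boxplus_s_eqI:
  assumes "derivation A A' (lvl0 f) d" "\<And>b. b \<in> B \<Longrightarrow> d b = s b + u b"
  shows "boxplus_s A A' B f s u = d"
  unfolding boxplus_s_def using assms by (intro the_equality) (auto intro!: derivation_unique)

lemma boxplus_s:
  assumes f: "xmod2_map A A' f" and s: "derivation A A' (lvl0 f) s"
    and u: "derivation A A' (\<lambda>r. lvl0 f r + bd1 A' (s r)) u"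
  shows "boxplus_s A A' B f s u = (\<lambda>r. s r + u r - bd2 A' (wmap A A' B f s u r))"
  by (rule boxplus_s_eqI) (simp_all add: derivation_boxplus[OF assms] wmap(2)[OF assms])

text \<open>The laws for \<open>t\<close> use the recursion of \<open>w\<close> at
  \<open>bd1 e * bd1 e'\<close> and at \<open>r * bd1 e\<close>. In the target, \<open>w\<close>
  enters level 1 once with each sign.\<close>

lemma quad_derivation_boxplus:
  assumes f: "xmod2_map A A' f" and st: "quad_derivation A A' f s t"
    and uv: "quad_derivation A A' (htpy_target A A' f s t) u v"
  shows "quad_derivation A A' f (boxplus_s A A' B f s u) (boxplus_t A A' B f s t u v)"
    and "htpy_target A A' f (boxplus_s A A' B f s u) (boxplus_t A A' B f s t u v) =
      htpy_target A A' (htpy_target A A' f s t) u v"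
proof -
  note s = quad_derivation_rules(1)[OF st]
  note u = quad_derivation_rules(1)[OF uv, simplified]
  note rules = xmod2_map_rules[OF f] quad_derivation_rules[OF st] quad_derivation_rules[OF uv]
    derivation_rules[OF s] derivation_rules[OF u] wmap[OF f s u] klinearD[OF wmap(1)[OF f s u]]
  show "quad_derivation A A' f (boxplus_s A A' B f s u) (boxplus_t A A' B f s t u v)"
    unfolding quad_derivation_def boxplus_s[OF f s u] boxplus_t_def klinear_def
    by (intro conjI allI derivation_boxplus[OF f s u])
      (simp_all add: rules, simp_all add: A'.xmod2_simps)
  show "htpy_target A A' f (boxplus_s A A' B f s u) (boxplus_t A A' B f s t u v) =
      htpy_target A A' (htpy_target A A' f s t) u v"
    by (simp add: htpy_target_def boxplus_s[OF f s u] boxplus_t_def rules algebra_simps)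
qed

text \<open>If one argument is zero, the lifting terms disappear from the recursion, and zero values
  on \<open>B\<close> propagate.\<close>

lemma wmap_zero:
  assumes f: "xmod2_map A A' f" and u: "derivation A A' (lvl0 f) u"
  shows "wmap A A' B f (\<lambda>_. 0) u = (\<lambda>_. 0)" "wmap A A' B f u (\<lambda>_. 0) = (\<lambda>_. 0)"
proof -
  have 0: "derivation A A' g (\<lambda>_. 0)" for g by (simp add: derivation_def klinear_def)
  have u': "derivation A A' (\<lambda>r. lvl0 f r + bd1 A' ((\<lambda>_. 0) r)) u" using u by simp
  note w = wmap[OF f 0 u'] klinearD[OF wmap(1)[OF f 0 u']]
  note w' = wmap[OF f u 0] klinearD[OF wmap(1)[OF f u 0]]
  have "wmap A A' B f (\<lambda>_. 0) u r = 0 \<and> wmap A A' B f u (\<lambda>_. 0) r = 0" for r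
    by (induction r rule: gen_induct) (simp_all add: w w')
  then show "wmap A A' B f (\<lambda>_. 0) u = (\<lambda>_. 0)" "wmap A A' B f u (\<lambda>_. 0) = (\<lambda>_. 0)" by auto
qed

text \<open>
  Both sides solve the same recursion along products, with zero initial values on \<open>B\<close>; this
  recursion mentions only \<open>s\<close>, \<open>u\<close> and \<open>x\<close>.
\<close>

lemma wmap_cocycle:
  assumes f: "xmod2_map A A' f" and g: "xmod2_map A A' g" and g0: "lvl0 g = (\<lambda>r. lvl0 f r + bd1 A' (s r))"
    and s: "derivation A A' (lvl0 f) s"
    and u: "derivation A A' (lvl0 g) u"
    and x: "derivation A A' (\<lambda>r. lvl0 g r + bd1 A' (u r)) x"
  shows "wmap A A' B f s u r + wmap A A' B f (boxplus_s A A' B f s u) x r =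
    wmap A A' B g u x r + wmap A A' B f s (boxplus_s A A' B g u x) r"
proof -
  note u' = u[unfolded g0]
  note su = boxplus_s[OF f s u'] and ux = boxplus_s[OF g u x]
  note dsu = derivation_boxplus[OF f s u'] and dux = derivation_boxplus[OF g u x]
  \<comment> \<open>\<open>bd1\<close> kills the correction \<open>bd2 w\<close>, so
    \<open>x\<close> is a derivation over the target of the composite of \<open>s\<close> and
    \<open>u\<close>.\<close>
  have x': "derivation A A' (\<lambda>r. lvl0 f r + bd1 A' (s r + u r - bd2 A' (wmap A A' B f s u r))) x"
    using x by (simp add: g0 add.assoc)
  note dux' = dux[unfolded g0]
  note lin = wmap(1)[OF f s u'] wmap(1)[OF g u x] wmap(1)[OF f dsu x'] wmap(1)[OF f s dux']
  note rules = wmap(2,3)[OF f s u'] wmap(2,3)[OF g u x] wmap(2,3)[OF f dsu x'] wmap(2,3)[OF f s dux']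
    lin[THEN klinearD(1)] lin[THEN klinearD(2)] lin[THEN klinearD(3)] lin[THEN klinearD(4)] g0
  define sol where "sol W \<longleftrightarrow> klinear (smR A) (smL A') W \<and> (\<forall>b\<in>B. W b = 0) \<and>
    (\<forall>r r'. W (r * r') = actL A' (lvl0 f r) (W r') + actL A' (lvl0 f r') (W r)
       + actp A' (s r + u r + x r) (W r') + actp A' (s r' + u r' + x r') (W r) - W r * W r'
       - pf A' (u r) (s r') - pf A' (u r') (s r) - pf A' (x r) (s r' + u r') - pf A' (x r') (s r + u r))" for W
  \<comment> \<open>The \<open>bd2 w\<close> inside the combined derivation supplies the mixed
    products of the two summands and, through the lifting with \<open>x\<close>, the missing action
    of \<open>x\<close> on \<open>w(s,u)\<close>.\<close>
  have sol1: "sol (\<lambda>r. wmap A A' B f s u r + wmap A A' B f (\<lambda>r. s r + u r - bd2 A' (wmap A A' B f s u r)) x r)"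
    unfolding sol_def klinear_def by (simp add: rules) (simp add: A'.xmod2_simps)
  \<comment> \<open>Here (2XM4) turns the lifting of \<open>bd2 w\<close> with \<open>s\<close> into
    the missing action of \<open>s\<close>, minus that of \<open>bd1 s\<close>, which cancels the
    surplus from the base map \<open>g\<close>.\<close>
  have sol2: "sol (\<lambda>r. wmap A A' B g u x r + wmap A A' B f s (\<lambda>r. u r + x r - bd2 A' (wmap A A' B g u x r)) r)"
    unfolding sol_def klinear_def by (simp add: rules) (simp add: A'.xmod2_simps)
  have unique: "V r = W r" if V: "sol V" and W: "sol W" for V W
  proof -
    note linV = klinearD[OF conjunct1[OF V[unfolded sol_def]]]
    note linW = klinearD[OF conjunct1[OF W[unfolded sol_def]]]
    show ?thesis
      by (induction r rule: gen_induct) (use V W in \<open>simp_all add: linV linW\<close>, auto simp: sol_def)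
  qed
  show ?thesis unfolding su ux using unique[OF sol1 sol2] .
qed

lemma htpy_inverse:
  assumes f: "xmod2_map A A' f" and st: "quad_derivation A A' f s t"
  obtains u v where "quad_derivation A A' (htpy_target A A' f s t) u v"
    "boxplus_s A A' B f s u = (\<lambda>_. 0)" "boxplus_t A A' B f s t u v = (\<lambda>_. 0)"
proof -
  let ?g = "htpy_target A A' f s t"
  have g: "xmod2_map A A' ?g" by (rule xmod2_map_htpy_target[OF f st])
  obtain u where u: "derivation A A' (lvl0 ?g) u" "\<And>b. b \<in> B \<Longrightarrow> u b = - s b"
    using derivation_extend[OF g, of "\<lambda>b. - s b"] by blast
  note s = quad_derivation_rules(1)[OF st]
  note u' = u(1)[simplified]
  define w where "w = wmap A A' B f s u"
  note w = wmap[OF f s u', folded w_def]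
  have su: "boxplus_s A A' B f s u = (\<lambda>_. 0)"
    by (rule boxplus_s_eqI) (simp_all add: u derivation_def klinear_def)
  \<comment> \<open>The vanishing composite is read backwards: it gives \<open>u\<close> in closed
    form, so that the laws for the inverse can be computed.\<close>
  have "u r = bd2 A' (w r) - s r" for r
    using boxplus_s[OF f s u'] su by (simp add: w_def fun_eq_iff algebra_simps eq_neg_iff_add_eq_0)
  then have ueq: "u = (\<lambda>r. bd2 A' (w r) - s r)" by (rule ext)
  note rules = xmod2_map_rules[OF f] quad_derivation_rules[OF st]
    derivation_rules[OF s] w[unfolded ueq] klinearD[OF w(1)]
  \<comment> \<open>The value forced by \<open>t + v + w \<circ> bd1 = 0\<close>.\<close>
  let ?v = "\<lambda>e. - t e - w (bd1 A e)"
  have "quad_derivation A A' ?g u ?v"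
    unfolding quad_derivation_def klinear_def ueq
    by (intro conjI allI u(1)[unfolded ueq]) (simp_all add: rules, simp_all add: A'.xmod2_simps)
  moreover have "boxplus_t A A' B f s t u ?v = (\<lambda>_. 0)" by (simp add: boxplus_t_def w_def)
  ultimately show ?thesis using that su by blast
qed

section \<open>Horizontal composition, whiskering and interchange\<close>

text \<open>The terms \<open>w(s,u) - w(s',u')\<close> exchange the correction in the source
  composite for the one in the target composite. The product law is the difference of the two
  recursions for \<open>w\<close> combined with the laws of \<open>q\<close> and
  \<open>q'\<close>.\<close>

lemma horiz_comp:
  assumes f: "xmod2_map A A' f" and q: "quad_2derivation A A' f s t q"
    and q': "quad_2derivation A A' (htpy_target A A' f s t) u v q'"
  defines "su \<equiv> boxplus_s A A' B f s u" and "tv \<equiv> boxplus_t A A' B f s t u v"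
    and "qq \<equiv> horiz_comp A A' B f s (cell_target_s A' s q) q u (cell_target_s A' u q') q'"
  shows "quad_2derivation A A' f su tv qq"
    and "cell_target_s A' su qq = boxplus_s A A' B f (cell_target_s A' s q) (cell_target_s A' u q')"
    and "cell_target_t A tv qq = boxplus_t A A' B f (cell_target_s A' s q) (cell_target_t A t q)
      (cell_target_s A' u q') (cell_target_t A v q')"
proof -
  let ?g = "htpy_target A A' f s t"
  have st: "quad_derivation A A' f s t" and uv: "quad_derivation A A' ?g u v"
    using q q' by (simp_all add: quad_2derivation_def)
  have g: "xmod2_map A A' ?g" by (rule xmod2_map_htpy_target[OF f st])
  let ?s = "cell_target_s A' s q" and ?u = "cell_target_s A' u q'"
  note s = quad_derivation_rules(1)[OF st]
  note u = quad_derivation_rules(1)[OF uv, simplified]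
  note s' = quad_derivation_rules(1)[OF cell_target(1)[OF f q]]
  \<comment> \<open>Hence the primed derivations have the same base map, and \<open>w(s',u')\<close>
    obeys its recursion.\<close>
  have s0: "bd1 A' (?s r) = bd1 A' (s r)" for r by (simp add: cell_target_s_def)
  have u': "derivation A A' (\<lambda>r. lvl0 f r + bd1 A' (?s r)) ?u"
    using quad_derivation_rules(1)[OF cell_target(1)[OF g q']] by (simp add: s0)
  note rules = xmod2_map_rules[OF f] quad_derivation_rules[OF st] quad_derivation_rules[OF uv]
    quad_2derivation_rules[OF q] quad_2derivation_rules[OF q']
    derivation_rules[OF s] derivation_rules[OF u] wmap[OF f s u] klinearD[OF wmap(1)[OF f s u]]
    wmap[OF f s' u'] klinearD[OF wmap(1)[OF f s' u']]
  show "quad_2derivation A A' f su tv qq"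
    unfolding su_def tv_def qq_def quad_2derivation_def klinear_def horiz_comp_def
    \<comment> \<open>\<open>cell_target_s\<close> stays folded in the first pass so that the rules
      for the primed \<open>wmap\<close> match.\<close>
    by (intro conjI allI quad_derivation_boxplus(1)[OF f st uv], unfold boxplus_s[OF f s u])
      (simp_all add: rules, simp_all add: cell_target_s_def A'.xmod2_simps)
  show "cell_target_s A' su qq = boxplus_s A A' B f ?s ?u"
    unfolding su_def qq_def boxplus_s[OF f s u] boxplus_s[OF f s' u']
    by (simp add: cell_target_s_def horiz_comp_def algebra_simps)
  show "cell_target_t A tv qq = boxplus_t A A' B f ?s (cell_target_t A t q) ?u (cell_target_t A v q')"
    by (simp add: tv_def qq_def cell_target_t_def horiz_comp_def boxplus_t_def algebra_simps)
qed

lemma quad_2derivation_zero: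
  "quad_derivation A A' f s t \<Longrightarrow> quad_2derivation A A' f s t (\<lambda>_. 0)"
  by (simp add: quad_2derivation_def klinear_def)

lemma cell_target_zero [simp]: "cell_target_s A' s (\<lambda>_. 0) = s" "cell_target_t A t (\<lambda>_. 0) = t"
  by (simp_all add: cell_target_s_def cell_target_t_def)

text \<open>Horizontal composition with a zero 2-cell is a 2-derivation over the right pair, and it
  agrees with \<open>q\<close> on \<open>B\<close> because both \<open>w\<close> terms vanish there;
  uniqueness does the rest.\<close>

lemma whisker_right:
  assumes f: "xmod2_map A A' f" and q: "quad_2derivation A A' f s t q"
    and uv: "quad_derivation A A' (htpy_target A A' f s t) u v"
  shows "whisker_right A A' B f s t q u v =
    (\<lambda>r. q r + wmap A A' B f s u r - wmap A A' B f (cell_target_s A' s q) u r)"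
  unfolding whisker_right_def
proof (rule the_equality, intro conjI ballI)
  note hc = horiz_comp(1)[OF f q quad_2derivation_zero[OF uv], unfolded horiz_comp_def, simplified]
  show "quad_2derivation A A' f (boxplus_s A A' B f s u) (boxplus_t A A' B f s t u v)
    (\<lambda>r. q r + wmap A A' B f s u r - wmap A A' B f (cell_target_s A' s q) u r)" by (rule hc)
  have st: "quad_derivation A A' f s t" using q by (simp add: quad_2derivation_def)
  have "derivation A A' (\<lambda>r. lvl0 f r + bd1 A' (cell_target_s A' s q r)) u"
    using quad_derivation_rules(1)[OF uv] by (simp add: cell_target_s_def)
  note w = wmap(2)[OF f _ quad_derivation_rules(1)[OF uv, simplified]]
    wmap(2)[OF f _ this]
  show gen: "q b + wmap A A' B f s u b - wmap A A' B f (cell_target_s A' s q) u b = q b" if "b \<in> B" for b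
    using that w quad_derivation_rules(1)[OF st] quad_derivation_rules(1)[OF cell_target(1)[OF f q]] by simp
  fix p assume "quad_2derivation A A' f (boxplus_s A A' B f s u) (boxplus_t A A' B f s t u v) p \<and> (\<forall>b\<in>B. p b = q b)"
  then show "p = (\<lambda>r. q r + wmap A A' B f s u r - wmap A A' B f (cell_target_s A' s q) u r)"
    using hc gen by (auto intro!: quad_2derivation_unique)
qed

lemma whisker_left:
  assumes f: "xmod2_map A A' f" and st: "quad_derivation A A' f s t"
    and q': "quad_2derivation A A' (htpy_target A A' f s t) u v q'"
  shows "whisker_left A A' B f s t u v q' =
    (\<lambda>r. q' r + wmap A A' B f s u r - wmap A A' B f s (cell_target_s A' u q') r)"
  unfolding whisker_left_def
proof (rule the_equality, intro conjI ballI)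
  note hc = horiz_comp(1)[OF f quad_2derivation_zero[OF st] q', unfolded horiz_comp_def, simplified]
  show "quad_2derivation A A' f (boxplus_s A A' B f s u) (boxplus_t A A' B f s t u v)
    (\<lambda>r. q' r + wmap A A' B f s u r - wmap A A' B f s (cell_target_s A' u q') r)" by (rule hc)
  note g = xmod2_map_htpy_target[OF f st]
  have uv: "quad_derivation A A' (htpy_target A A' f s t) u v" using q' by (simp add: quad_2derivation_def)
  note w = wmap(2)[OF f _ quad_derivation_rules(1)[OF uv, simplified]]
    wmap(2)[OF f _ quad_derivation_rules(1)[OF cell_target(1)[OF g q'], simplified]]
  show gen: "q' b + wmap A A' B f s u b - wmap A A' B f s (cell_target_s A' u q') b = q' b" if "b \<in> B" for b
    using that w quad_derivation_rules(1)[OF st] by simp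
  fix p assume "quad_2derivation A A' f (boxplus_s A A' B f s u) (boxplus_t A A' B f s t u v) p \<and> (\<forall>b\<in>B. p b = q' b)"
  then show "p = (\<lambda>r. q' r + wmap A A' B f s u r - wmap A A' B f s (cell_target_s A' u q') r)"
    using hc gen by (auto intro!: quad_2derivation_unique)
qed

text \<open>In one order \<open>w(s',u)\<close> occurs with both signs, in the other
  \<open>w(s,u')\<close>.\<close>

lemma interchange:
  assumes "xmod2_map A A' f" "homotopy A A' f s t g" "homotopy A A' f s' t' g"
    "homotopy A A' g u v h" "homotopy A A' g u' v' h"
    "connects A A' f s t q s' t'" "connects A A' g u v q' u' v'"
  shows "vert_comp (whisker_right A A' B f s t q u v) (whisker_left A A' B f s' t' u v q')
                = horiz_comp A A' B f s s' q u u' q'"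
    and "vert_comp (whisker_left A A' B f s t u v q') (whisker_right A A' B f s t q u' v')
                = horiz_comp A A' B f s s' q u u' q'"
    and "connects A A' f
                (boxplus_s A A' B f s u) (boxplus_t A A' B f s t u v)
                (horiz_comp A A' B f s s' q u u' q')
                (boxplus_s A A' B f s' u') (boxplus_t A A' B f s' t' u' v')"
proof -
  have st: "quad_derivation A A' f s t" "quad_derivation A A' f s' t'"
    and g: "htpy_target A A' f s t = g" "htpy_target A A' f s' t' = g"
    and uv: "quad_derivation A A' g u v" "quad_derivation A A' g u' v'"
    and q: "quad_2derivation A A' f s t q" "s' = cell_target_s A' s q" "t' = cell_target_t A t q"
    and q': "quad_2derivation A A' g u v q'" "u' = cell_target_s A' u q'" "v' = cell_target_t A v q'"
    using assms by (simp_all add: homotopy_def connects_def)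
  note right = whisker_right[OF assms(1) q(1), unfolded g, folded q(2)]
    and left = whisker_left[OF assms(1), of s t, unfolded g, OF st(1) q'(1), folded q'(2)]
      whisker_left[OF assms(1), of s' t', unfolded g, OF st(2) q'(1), folded q'(2)]
  show "vert_comp (whisker_right A A' B f s t q u v) (whisker_left A A' B f s' t' u v q')
                = horiz_comp A A' B f s s' q u u' q'"
    "vert_comp (whisker_left A A' B f s t u v q') (whisker_right A A' B f s t q u' v')
                = horiz_comp A A' B f s s' q u u' q'"
    unfolding right[OF uv(1)] right[OF uv(2)] left by (auto simp: vert_comp_def horiz_comp_def)
  show "connects A A' f
                (boxplus_s A A' B f s u) (boxplus_t A A' B f s t u v)
                (horiz_comp A A' B f s s' q u u' q')
                (boxplus_s A A' B f s' u') (boxplus_t A A' B f s' t' u' v')"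
    using horiz_comp[OF assms(1) q(1), unfolded g, OF q'(1), folded q(2,3) q'(2,3)]
    by (simp add: connects_def)
qed

section \<open>Units and associativity of concatenation\<close>

lemma quad_derivation_zero: "xmod2_map A A' f \<Longrightarrow> quad_derivation A A' f (\<lambda>_. 0) (\<lambda>_. 0)"
  by (simp add: quad_derivation_def derivation_def klinear_def)

lemma htpy_target_zero [simp]: "htpy_target A A' f (\<lambda>_. 0) (\<lambda>_. 0) = f"
  by (simp add: htpy_target_def)

lemma boxplus_zero:
  assumes f: "xmod2_map A A' f" and st: "quad_derivation A A' f s t"
  shows "boxplus_s A A' B f (\<lambda>_. 0) s = s" "boxplus_t A A' B f (\<lambda>_. 0) (\<lambda>_. 0) s t = t"
    "boxplus_s A A' B f s (\<lambda>_. 0) = s" "boxplus_t A A' B f s t (\<lambda>_. 0) (\<lambda>_. 0) = t"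
  using quad_derivation_rules(1)[OF st] wmap_zero[OF f quad_derivation_rules(1)[OF st]]
  by (auto intro!: boxplus_s_eqI simp: boxplus_t_def)

text \<open>The cocycle identity gives both laws: its image under \<open>bd2\<close> for the
  derivations, its values at \<open>bd1 e\<close> for the second components.\<close>

lemma boxplus_assoc:
  assumes f: "xmod2_map A A' f" and st: "quad_derivation A A' f s t"
    and uv: "quad_derivation A A' (htpy_target A A' f s t) u v"
    and xy: "quad_derivation A A' (htpy_target A A' (htpy_target A A' f s t) u v) x y"
  defines "g \<equiv> htpy_target A A' f s t"
  defines "su \<equiv> boxplus_s A A' B f s u" and "tv \<equiv> boxplus_t A A' B f s t u v"
    and "ux \<equiv> boxplus_s A A' B g u x" and "vy \<equiv> boxplus_t A A' B g u v x y"
  shows "boxplus_s A A' B f su x = boxplus_s A A' B f s ux"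
    and "boxplus_t A A' B f su tv x y = boxplus_t A A' B f s t ux vy"
    and "wmap A A' B f s u r + wmap A A' B f su x r = wmap A A' B g u x r + wmap A A' B f s ux r"
proof -
  have g: "xmod2_map A A' g" unfolding g_def by (rule xmod2_map_htpy_target[OF f st])
  note uv = uv[folded g_def] and xy = xy[folded g_def]
  have g0: "lvl0 g = (\<lambda>r. lvl0 f r + bd1 A' (s r))" by (simp add: g_def)
  note s = quad_derivation_rules(1)[OF st]
  note u = quad_derivation_rules(1)[OF uv]
  note x = quad_derivation_rules(1)[OF xy, simplified]
  show w: "wmap A A' B f s u r + wmap A A' B f su x r = wmap A A' B g u x r + wmap A A' B f s ux r" for r
    unfolding su_def ux_def by (rule wmap_cocycle[OF f g g0 s u x])
  note su = boxplus_s[OF f s u[unfolded g0], folded su_def]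
  note ux = boxplus_s[OF g u x, folded ux_def]
  have suv: "quad_derivation A A' f su tv" "htpy_target A A' f su tv = htpy_target A A' g u v"
    using quad_derivation_boxplus[OF f st] uv by (simp_all add: su_def tv_def g_def)
  have uxy: "quad_derivation A A' g ux vy"
    using quad_derivation_boxplus[OF g uv xy] by (simp add: ux_def vy_def)
  have "boxplus_s A A' B f su x r = boxplus_s A A' B f s ux r" for r
  proof -
    have 1: "boxplus_s A A' B f su x = (\<lambda>r. su r + x r - bd2 A' (wmap A A' B f su x r))"
      using quad_derivation_rules(1)[OF xy, folded suv(2)]
      by (intro boxplus_s[OF f quad_derivation_rules(1)[OF suv(1)]]) simp
    have 2: "boxplus_s A A' B f s ux = (\<lambda>r. s r + ux r - bd2 A' (wmap A A' B f s ux r))"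
      using quad_derivation_rules(1)[OF uxy]
      by (intro boxplus_s[OF f s]) (simp add: g0)
    have "bd2 A' (wmap A A' B f su x r) + bd2 A' (wmap A A' B f s u r) = bd2 A' (wmap A A' B g u x r) + bd2 A' (wmap A A' B f s ux r)"
      using arg_cong[OF w[of r], of "bd2 A'"] by (simp add: add.commute)
    then show ?thesis by (simp add: 1 2 fun_cong[OF su] fun_cong[OF ux] algebra_simps)
  qed
  then show "boxplus_s A A' B f su x = boxplus_s A A' B f s ux" ..
  show "boxplus_t A A' B f su tv x y = boxplus_t A A' B f s t ux vy"
    using w by (simp add: boxplus_t_def tv_def vy_def fun_eq_iff algebra_simps)
qed

section \<open>Vertical composition\<close>

text \<open>The shift of \<open>s\<close> by \<open>bd2 q\<close> produces, by
  \<open>actp_bd2\<close>, the mixed products of \<open>q\<close> and \<open>p\<close>; with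
  \<open>- q\<close> for \<open>p\<close> it corrects the sign of the quadratic term.\<close>

lemma vert_comp:
  assumes f: "xmod2_map A A' f" and q: "quad_2derivation A A' f s t q"
  shows "quad_2derivation A A' f (cell_target_s A' s q) (cell_target_t A t q) p \<Longrightarrow>
      quad_2derivation A A' f s t (vert_comp q p)"
    and "quad_2derivation A A' f (cell_target_s A' s q) (cell_target_t A t q) (\<lambda>r. - q r)"
proof -
  note rules = quad_2derivation_rules[OF q]
  have st: "quad_derivation A A' f s t" using q by (simp add: quad_2derivation_def)
  show "quad_2derivation A A' f s t (vert_comp q p)"
    if p: "quad_2derivation A A' f (cell_target_s A' s q) (cell_target_t A t q) p"
    unfolding quad_2derivation_def
    using st by (simp add: rules quad_2derivation_rules[OF p] klinear_def vert_comp_def cell_target_s_def)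
      (simp add: A'.xmod2_simps)
  show "quad_2derivation A A' f (cell_target_s A' s q) (cell_target_t A t q) (\<lambda>r. - q r)"
    unfolding quad_2derivation_def
    using cell_target(1)[OF f q] by (simp add: rules klinear_def cell_target_s_def)
      (simp add: A'.xmod2_simps)
qed

section \<open>The 2-groupoid\<close>

lemma HOM2_arrows:
  "is_category (Obj (HOM2 A A' B)) (Arr (HOM2 A A' B)) (dom1 (HOM2 A A' B)) (cod1 (HOM2 A A' B))
     (id1 (HOM2 A A' B)) (cmp1 (HOM2 A A' B))"
  unfolding is_category_def HOM2_def
  by (auto simp: xmod2_map_htpy_target quad_derivation_zero quad_derivation_boxplus boxplus_zero boxplus_assoc)

lemma HOM2_cells_vert:
  "is_category (Arr (HOM2 A A' B)) (Cell (HOM2 A A' B)) (src2 (HOM2 A A' B)) (trg2 (HOM2 A A' B))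
     (id2 (HOM2 A A' B)) (vcmp (HOM2 A A' B))"
  unfolding is_category_def HOM2_def
  by (auto simp: cell_target quad_2derivation_zero vert_comp)
    (auto simp: quad_2derivation_def vert_comp_def cell_target_s_def cell_target_t_def algebra_simps)

lemma horiz_comp_zero:
  assumes f: "xmod2_map A A' f" and q: "quad_2derivation A A' f s t q"
  shows "horiz_comp A A' B f (\<lambda>_. 0) (\<lambda>_. 0) (\<lambda>_. 0) s (cell_target_s A' s q) q = q"
    "horiz_comp A A' B f s (cell_target_s A' s q) q (\<lambda>_. 0) (\<lambda>_. 0) (\<lambda>_. 0) = q"
proof -
  have "quad_derivation A A' f s t" using q by (simp add: quad_2derivation_def)
  then have "derivation A A' (lvl0 f) s" "derivation A A' (lvl0 f) (cell_target_s A' s q)"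
    using cell_target(1)[OF f q] by (auto dest: quad_derivation_rules(1))
  then show "horiz_comp A A' B f (\<lambda>_. 0) (\<lambda>_. 0) (\<lambda>_. 0) s (cell_target_s A' s q) q = q"
    "horiz_comp A A' B f s (cell_target_s A' s q) q (\<lambda>_. 0) (\<lambda>_. 0) (\<lambda>_. 0) = q"
    by (simp_all add: horiz_comp_def wmap_zero[OF f])
qed

text \<open>The \<open>w\<close> terms of a horizontal composite are those of its source minus those
  of its target, so the claim is the difference of the cocycle identities for the two
  triples.\<close>

lemma horiz_comp_assoc:
  assumes f: "xmod2_map A A' f" and q: "quad_2derivation A A' f s t q"
    and q': "quad_2derivation A A' (htpy_target A A' f s t) u v q'"
    and q'': "quad_2derivation A A' (htpy_target A A' (htpy_target A A' f s t) u v) x y q''"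
  defines "g \<equiv> htpy_target A A' f s t"
    and "s' \<equiv> cell_target_s A' s q" and "u' \<equiv> cell_target_s A' u q'" and "x' \<equiv> cell_target_s A' x q''"
  shows "horiz_comp A A' B f (boxplus_s A A' B f s u) (boxplus_s A A' B f s' u')
      (horiz_comp A A' B f s s' q u u' q') x x' q'' =
    horiz_comp A A' B f s s' q (boxplus_s A A' B g u x) (boxplus_s A A' B g u' x')
      (horiz_comp A A' B g u u' q' x x' q'')"
proof
  fix r
  have st: "quad_derivation A A' f s t" using q by (simp add: quad_2derivation_def)
  have g: "xmod2_map A A' g" unfolding g_def by (rule xmod2_map_htpy_target[OF f st])
  note q' = q'[folded g_def] and q'' = q''[folded g_def]
  have uv: "quad_derivation A A' g u v" using q' by (simp add: quad_2derivation_def)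
  have h: "xmod2_map A A' (htpy_target A A' g u v)" by (rule xmod2_map_htpy_target[OF g uv])
  have xy: "quad_derivation A A' (htpy_target A A' g u v) x y" using q'' by (simp add: quad_2derivation_def)
  note t = cell_target[OF f q, folded g_def s'_def] cell_target[OF g q', folded u'_def] cell_target[OF h q'', folded x'_def]
  have 1: "wmap A A' B f s u r + wmap A A' B f (boxplus_s A A' B f s u) x r =
      wmap A A' B g u x r + wmap A A' B f s (boxplus_s A A' B g u x) r"
    using boxplus_assoc(3)[OF f st] uv xy unfolding g_def by blast
  \<comment> \<open>The target triple is composable because a 2-cell does not change the target map
    of its homotopy.\<close>
  have 2: "wmap A A' B f s' u' r + wmap A A' B f (boxplus_s A A' B f s' u') x' r =
      wmap A A' B g u' x' r + wmap A A' B f s' (boxplus_s A A' B g u' x') r"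
    using boxplus_assoc(3)[OF f t(1), unfolded t(2)] t(3)
      boxplus_assoc(3)[OF f t(1), unfolded t(2), OF t(3), unfolded t(4), OF t(5)] by blast
  show "horiz_comp A A' B f (boxplus_s A A' B f s u) (boxplus_s A A' B f s' u')
      (horiz_comp A A' B f s s' q u u' q') x x' q'' r =
    horiz_comp A A' B f s s' q (boxplus_s A A' B g u x) (boxplus_s A A' B g u' x')
      (horiz_comp A A' B g u u' q' x x' q'') r"
    using arg_cong2[OF 1 2, of "(-)"] by (simp add: horiz_comp_def algebra_simps)
qed

lemma HOM2_cells_horiz:
  "is_category (Obj (HOM2 A A' B)) (Cell (HOM2 A A' B)) (\<lambda>x. dom1 (HOM2 A A' B) (src2 (HOM2 A A' B) x))
     (\<lambda>x. cod1 (HOM2 A A' B) (src2 (HOM2 A A' B) x))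
     (\<lambda>a. id2 (HOM2 A A' B) (id1 (HOM2 A A' B) a)) (hcmp (HOM2 A A' B))"
proof -
  have st: "quad_derivation A A' f s t" if "quad_2derivation A A' f s t q" for f s t q
    using that by (simp add: quad_2derivation_def)
  show ?thesis
    unfolding is_category_def HOM2_def
    by (auto simp: xmod2_map_htpy_target st quad_2derivation_zero quad_derivation_zero
        quad_derivation_boxplus boxplus_zero boxplus_assoc horiz_comp horiz_comp_zero horiz_comp_assoc
        boxplus_zero(1,3)[OF _ st] boxplus_assoc(1)[OF _ st st st])
qed

lemma HOM2_invertible:
  "all_invertible (Arr (HOM2 A A' B)) (dom1 (HOM2 A A' B)) (cod1 (HOM2 A A' B))
     (id1 (HOM2 A A' B)) (cmp1 (HOM2 A A' B))"
proof (rule all_invertible_if_right_inverse[OF HOM2_arrows])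
  fix x assume mem: "x \<in> Arr (HOM2 A A' B)"
  obtain f s t where x: "x = (f, s, t)" and f: "xmod2_map A A' f" and st: "quad_derivation A A' f s t"
    using mem by (cases x) (auto simp: HOM2_def)
  obtain u v where uv: "quad_derivation A A' (htpy_target A A' f s t) u v"
    "boxplus_s A A' B f s u = (\<lambda>_. 0)" "boxplus_t A A' B f s t u v = (\<lambda>_. 0)"
    by (rule htpy_inverse[OF f st])
  \<comment> \<open>The composite is the zero homotopy, whose target is \<open>f\<close>.\<close>
  have "htpy_target A A' (htpy_target A A' f s t) u v = f"
    using quad_derivation_boxplus(2)[OF f st uv(1)] by (simp add: uv)
  then show "\<exists>y\<in>Arr (HOM2 A A' B). dom1 (HOM2 A A' B) y = cod1 (HOM2 A A' B) x \<and>
      cod1 (HOM2 A A' B) y = dom1 (HOM2 A A' B) x \<and>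
      cmp1 (HOM2 A A' B) x y = id1 (HOM2 A A' B) (dom1 (HOM2 A A' B) x)"
    using uv xmod2_map_htpy_target[OF f st]
    by (intro bexI[of _ "(htpy_target A A' f s t, u, v)"]) (simp_all add: x HOM2_def)
qed

lemma HOM2_cells_invertible:
  "all_invertible (Cell (HOM2 A A' B)) (src2 (HOM2 A A' B)) (trg2 (HOM2 A A' B))
     (id2 (HOM2 A A' B)) (vcmp (HOM2 A A' B))"
proof -
  have "\<exists>y\<in>Cell (HOM2 A A' B). src2 (HOM2 A A' B) y = trg2 (HOM2 A A' B) x \<and> trg2 (HOM2 A A' B) y = src2 (HOM2 A A' B) x \<and>
     vcmp (HOM2 A A' B) x y = id2 (HOM2 A A' B) (src2 (HOM2 A A' B) x) \<and> vcmp (HOM2 A A' B) y x = id2 (HOM2 A A' B) (trg2 (HOM2 A A' B) x)"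
    if mem: "x \<in> Cell (HOM2 A A' B)" for x
  proof -
    obtain f s t q where x: "x = (f, s, t, q)" and f: "xmod2_map A A' f" and q: "quad_2derivation A A' f s t q"
      using mem by (cases x) (auto simp: HOM2_def)
    show ?thesis
      by (intro bexI[of _ "(f, cell_target_s A' s q, cell_target_t A t q, \<lambda>r. - q r)"])
       (use f vert_comp(2)[OF f q] in \<open>simp_all add: x HOM2_def vert_comp_def cell_target_s_def cell_target_t_def\<close>)
  qed
  then show ?thesis unfolding all_invertible_def by blast
qed

text \<open>The interchange law for four cells telescopes: the \<open>w\<close> terms at the
  intermediate homotopies cancel in the vertical composite.\<close>

lemma two_groupoid_HOM2: "two_groupoid (HOM2 A A' B)"
  unfolding two_groupoid_def two_category_def
  by (intro conjI HOM2_arrows HOM2_cells_vert HOM2_cells_horiz HOM2_invertible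
      HOM2_cells_invertible; unfold HOM2_def)
    (auto simp: cell_target horiz_comp,
     auto simp: vert_comp_def horiz_comp_def cell_target_s_def algebra_simps)

end

theorem theorem4p7:
  fixes A :: "('k::comm_ring, 'l::comm_ring, 'e::comm_ring, 'r::comm_ring) xmod2"
    and A' :: "('k, 'm::comm_ring, 'd::comm_ring, 'q::comm_ring) xmod2"
    and B :: "'r set"
  assumes "is_xmod2 A"
    and "is_xmod2 A'"
    and "free_up_to_order_one A B"
  shows "(\<forall>f g h s t s' t' u v u' v' q q'.
            xmod2_map A A' f \<longrightarrow> xmod2_map A A' g \<longrightarrow> xmod2_map A A' h \<longrightarrow>
            homotopy A A' f s t g \<longrightarrow> homotopy A A' f s' t' g \<longrightarrow>
            homotopy A A' g u v h \<longrightarrow> homotopy A A' g u' v' h \<longrightarrow>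
            connects A A' f s t q s' t' \<longrightarrow> connects A A' g u v q' u' v' \<longrightarrow>
              vert_comp (whisker_right A A' B f s t q u v) (whisker_left A A' B f s' t' u v q')
                = vert_comp (whisker_left A A' B f s t u v q') (whisker_right A A' B f s t q u' v')
            \<and> vert_comp (whisker_right A A' B f s t q u v) (whisker_left A A' B f s' t' u v q')
                = (\<lambda>r. q r + q' r + wmap A A' B f s u r - wmap A A' B f s' u' r)
            \<and> vert_comp (whisker_left A A' B f s t u v q') (whisker_right A A' B f s t q u' v')
                = (\<lambda>r. q r + q' r + wmap A A' B f s u r - wmap A A' B f s' u' r)
            \<and> connects A A' f
                (boxplus_s A A' B f s u) (boxplus_t A A' B f s t u v)
                (horiz_comp A A' B f s s' q u u' q')
                (boxplus_s A A' B f s' u') (boxplus_t A A' B f s' t' u' v'))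
         \<and> two_groupoid (HOM2 A A' B)"
proof -
  interpret xmod2_pair A A' B
    using assms by unfold_locales (simp_all add: free_up_to_order_one_def)
  show ?thesis
    by (intro conjI allI impI two_groupoid_HOM2)
      (rule trans[OF interchange(1) interchange(2)[symmetric]]
         interchange[unfolded horiz_comp_def] interchange(3); assumption)+
qed

end
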